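(* Let $F(s)=\sum_{n=1}^\infty a(n)n^{-s}$ satisfy (I) and (II), and suppose that $\sum_{p\leq x}\frac{|a(p)|^2}{p}=(\kappa+o(1))\log\log x$ as $x\to\infty$ for some constant $\kappa>0$. Let $c\in\mathbb{C}$. Then the Dirichlet series $\log F(s)-c$ has no isolated vertical lines containing zeros in the half-plane $\sigma>1$.
   Context: Write $s=\sigma+it$. (I) $F(s)=\sum_{n\geq1}a(n)n^{-s}$ is absolutely convergent for $\sigma>1$; (II) $\log F(s)=\sum_p\sum_{k\geq1}b_F(p^k)p^{-ks}$ (over primes) is absolutely convergent for $\sigma>1$, with $|b_F(p^k)|\ll p^{k\theta}$ for all primes $p$, $k\geq1$, for some $\theta<\frac12$. A vertical line $\sigma=\beta_0$ ($\beta_0>1$) is an isolated vertical line containing zeros of a function $g$ if $g$ has a zero with real part $\beta_0$ and there is $\delta>0$ such that $g$ has no zeros $\beta+i\gamma$ with $0<|\beta-\beta_0|<\delta$. *)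

theory Defs
  imports "HOL-Analysis.Analysis" "HOL-Library.Landau_Symbols"
    "HOL-Computational_Algebra.Primes"
begin

definition dirichlet_series :: "(nat \<Rightarrow> complex) \<Rightarrow> complex \<Rightarrow> complex" where
  "dirichlet_series a s = (\<Sum>\<^sub>\<infinity>n\<in>{1..}. a n * of_nat n powr (-s))"

definition prime_power_term :: "(nat \<Rightarrow> complex) \<Rightarrow> complex \<Rightarrow> nat \<times> nat \<Rightarrow> complex" where
  "prime_power_term b s = (\<lambda>(p, k). b (p ^ k) * of_nat p powr (- (of_nat k * s)))"

text \<open>The coefficients \<open>b\<close> are only ever evaluated at prime powers.\<close>

definition log_dirichlet_series :: "(nat \<Rightarrow> complex) \<Rightarrow> complex \<Rightarrow> complex" where
  "log_dirichlet_series b s = (\<Sum>\<^sub>\<infinity>pk\<in>{p. prime p} \<times> {1..}. prime_power_term b s pk)"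

definition cond_I :: "(nat \<Rightarrow> complex) \<Rightarrow> bool" where
  "cond_I a \<longleftrightarrow>
     (\<forall>s. Re s > 1 \<longrightarrow> (\<lambda>n. norm (a n * of_nat n powr (-s))) summable_on {1..})"

text \<open>
  That the prime power series equals \<open>log F\<close> means that it is a logarithm of \<open>F\<close> on the
  half-plane of absolute convergence. Since it has no constant term, it is the branch that tends
  to \<open>0\<close> as \<open>Re s \<rightarrow> \<infinity>\<close>. In particular \<open>F\<close> does not vanish there and determines
  \<open>b\<close> at prime powers.
\<close>

definition cond_II :: "(nat \<Rightarrow> complex) \<Rightarrow> (nat \<Rightarrow> complex) \<Rightarrow> bool" where
  "cond_II a b \<longleftrightarrow>
     (\<forall>s. Re s > 1 \<longrightarrow>
        (\<lambda>pk. norm (prime_power_term b s pk)) summable_on ({p. prime p} \<times> {1..}) \<and>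
        exp (log_dirichlet_series b s) = dirichlet_series a s) \<and>
     (\<exists>\<theta><1/2. \<exists>C. \<forall>p k. prime p \<longrightarrow> k \<ge> 1 \<longrightarrow>
        norm (b (p ^ k)) \<le> C * real p powr (real k * \<theta>))"

text \<open>
  For \<open>\<beta>\<^sub>0 > 1\<close> and \<open>g\<close> defined by a series converging for \<open>Re s > 1\<close>, the values of \<open>g\<close>
  outside this half-plane are irrelevant, because \<open>\<delta>\<close> may be taken less than \<open>\<beta>\<^sub>0 - 1\<close>.
\<close>

definition isolated_zero_line :: "(complex \<Rightarrow> complex) \<Rightarrow> real \<Rightarrow> bool" where
  "isolated_zero_line g \<beta>\<^sub>0 \<longleftrightarrow>
     (\<exists>s. Re s = \<beta>\<^sub>0 \<and> g s = 0) \<and>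
     (\<exists>\<delta>>0. \<forall>s. 0 < \<bar>Re s - \<beta>\<^sub>0\<bar> \<and> \<bar>Re s - \<beta>\<^sub>0\<bar> < \<delta> \<longrightarrow> g s \<noteq> 0)"

end

theory Submission
  imports Defs "HOL-Complex_Analysis.Complex_Analysis"
begin

text \<open>
  Suppose the zeros of \<open>log F - c\<close> near \<open>Re s = \<beta>\<close> all lie on this line. By Kronecker's
  theorem every twist of \<open>log F\<close>, obtained by replacing \<open>s\<close> by \<open>s + \<i> * w p\<close> in the Euler factor
  at each prime \<open>p\<close>, is a uniform limit of vertical translates of \<open>log F\<close>, so by Hurwitz's theorem
  the same holds for all twists \<open>G\<close>. Write \<open>f\<^sub>p\<close> for the logarithm of the Euler factor
  at \<open>p\<close>, evaluated at the shifted point. Near a zero of \<open>G - c\<close> with \<open>f\<^sub>p' \<noteq> 0\<close>, solve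
  \<open>G = c\<close> for the shift \<open>w p\<close> as a holomorphic function of \<open>s\<close>. That this function is real only
  on the line forces \<open>f\<^sub>p' / G'\<close> to be real there, and the zero can be moved to
  every nearby point of the line by changing the real number \<open>w p\<close>.

  Moving the zero by means of one prime and applying this to two others, \<open>p\<close> and \<open>q\<close>, shows that
  \<open>f\<^sub>p' / f\<^sub>q'\<close> is real on a segment of the line, whence
  \<open>Re (f\<^sub>p'' / f\<^sub>p') = Re (f\<^sub>q'' / f\<^sub>q')\<close>. However, \<open>f\<^sub>p'' / f\<^sub>p'\<close> is close to \<open>- ln p\<close>
  for all large primes with \<open>norm (b p) \<ge> p powr - \<epsilon>\<close>, of which there are infinitely many by the
  asymptotic formula for the sum of \<open>norm (a p)\<^sup>2 / p\<close>.
\<close>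

section \<open>General Dirichlet series\<close>

text \<open>An arbitrary index set with possibly repeated exponents \<open>l i\<close> lets one
  theory serve \<open>F\<close> (exponents \<open>ln n\<close>), \<open>log F\<close> (pairs of a
  prime and a power), single Euler factors, and sums and products of such series.\<close>

definition gds :: "'i set \<Rightarrow> ('i \<Rightarrow> complex) \<Rightarrow> ('i \<Rightarrow> real) \<Rightarrow> complex \<Rightarrow> complex" where
  "gds I c l s = (\<Sum>\<^sub>\<infinity>i\<in>I. c i * exp (- (of_real (l i) * s)))"

text \<open>The norm of a term depends on \<open>Re s\<close> alone, so absolute convergence is
  asked at real points only. The bounds on derivatives rest on the exponents being
  nonnegative.\<close>

definition gds_conv :: "'i set \<Rightarrow> ('i \<Rightarrow> complex) \<Rightarrow> ('i \<Rightarrow> real) \<Rightarrow> bool" where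
  "gds_conv I c l \<longleftrightarrow> (\<forall>i\<in>I. 0 \<le> l i) \<and>
     (\<forall>\<sigma>>1. (\<lambda>i. norm (c i) * exp (- (l i * \<sigma>))) summable_on I)"

lemma norm_gds_term: "norm (c * exp (- (of_real l * s))) = norm c * exp (- (l * Re s))"
  by (simp add: norm_mult)

lemma gds_conv_abs_summable:
  assumes "gds_conv I c l" "Re s > 1"
  shows "(\<lambda>i. norm (c i * exp (- (of_real (l i) * s)))) summable_on I"
  using assms unfolding norm_gds_term gds_conv_def by blast

lemma gds_conv_summable:
  assumes "gds_conv I c l" "Re s > 1"
  shows "(\<lambda>i. c i * exp (- (of_real (l i) * s))) summable_on I"
  using gds_conv_abs_summable[OF assms] by (rule abs_summable_summable)

lemma gds_conv_bounded_mult: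
  assumes "gds_conv I c l" "\<And>i. i \<in> I \<Longrightarrow> norm (d i) \<le> B"
  shows "gds_conv I (\<lambda>i. d i * c i) l"
  unfolding gds_conv_def
proof (intro conjI allI impI)
  show "\<forall>i\<in>I. 0 \<le> l i" using assms(1) by (simp add: gds_conv_def)
  fix \<sigma> :: real assume "\<sigma> > 1"
  then have "(\<lambda>i. B * (norm (c i) * exp (- (l i * \<sigma>)))) summable_on I"
    using assms(1) by (intro summable_on_cmult_right) (simp add: gds_conv_def)
  then show "(\<lambda>i. norm (d i * c i) * exp (- (l i * \<sigma>))) summable_on I"
    by (rule summable_on_comparison_test)
       (use assms(2) in \<open>auto simp: norm_mult mult.assoc intro!: mult_right_mono\<close>)
qed

lemma gds_conv_subset:
  assumes "gds_conv I c l" "J \<subseteq> I"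
  shows "gds_conv J c l"
  using assms unfolding gds_conv_def by (meson subsetD summable_on_subset_banach)

lemma gds_conv_reindex:
  assumes "gds_conv I c l" "inj_on h J" "h ` J \<subseteq> I"
  shows "gds_conv J (c \<circ> h) (l \<circ> h)"
  unfolding gds_conv_def
proof (intro conjI allI impI)
  have *: "gds_conv (h ` J) c l" using assms gds_conv_subset by blast
  then show "\<forall>i\<in>J. 0 \<le> (l \<circ> h) i" by (auto simp: gds_conv_def)
  fix \<sigma> :: real assume "\<sigma> > 1"
  then have "(\<lambda>i. norm (c i) * exp (- (l i * \<sigma>))) summable_on (h ` J)"
    using * by (simp add: gds_conv_def)
  then show "(\<lambda>i. norm ((c \<circ> h) i) * exp (- ((l \<circ> h) i * \<sigma>))) summable_on J"
    using assms(2) by (simp add: summable_on_reindex o_def)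
qed

section \<open>Termwise differentiation\<close>

lemma mult_exp_neg_le:
  fixes x e :: real
  assumes "0 \<le> x" "e > 0"
  shows "x * exp (- (x * e)) \<le> 1 / e"
proof -
  have "x * e \<le> exp (x * e)" using exp_ge_add_one_self[of "x * e"] by linarith
  then have "x * e * exp (- (x * e)) \<le> 1"
    by (simp add: exp_minus field_simps)
  then show ?thesis using assms by (simp add: field_simps)
qed

text \<open>The extra factor \<open>l i\<close> is paid for by moving left by \<open>e\<close>, half
  the distance to \<open>1\<close>: \<open>l i * exp (- (l i * e)) \<le> 1 / e\<close>, and the
  original series still converges at \<open>\<sigma> - e\<close>.\<close>

lemma gds_conv_deriv:
  assumes "gds_conv I c l"
  shows "gds_conv I (\<lambda>i. - of_real (l i) * c i) l"
  unfolding gds_conv_def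
proof (intro conjI allI impI)
  show pos: "\<forall>i\<in>I. 0 \<le> l i" using assms by (simp add: gds_conv_def)
  fix \<sigma> :: real assume \<sigma>: "\<sigma> > 1"
  define e where "e = (\<sigma> - 1) / 2"
  have e: "e > 0" "\<sigma> - e > 1" using \<sigma> by (auto simp: e_def field_simps)
  have "(\<lambda>i. 1 / e * (norm (c i) * exp (- (l i * (\<sigma> - e))))) summable_on I"
    using assms e by (intro summable_on_cmult_right) (simp add: gds_conv_def)
  then show "(\<lambda>i. norm (- of_real (l i) * c i) * exp (- (l i * \<sigma>))) summable_on I"
  proof (rule summable_on_comparison_test)
    fix i assume i: "i \<in> I"
    have "norm (- of_real (l i) * c i) * exp (- (l i * \<sigma>))
          = (l i * exp (- (l i * e))) * (norm (c i) * exp (- (l i * (\<sigma> - e))))"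
      using pos i by (simp add: norm_mult exp_add[symmetric] algebra_simps)
    also have "\<dots> \<le> 1 / e * (norm (c i) * exp (- (l i * (\<sigma> - e))))"
      using pos i e by (intro mult_right_mono mult_exp_neg_le) auto
    finally show "norm (- of_real (l i) * c i) * exp (- (l i * \<sigma>))
        \<le> 1 / e * (norm (c i) * exp (- (l i * (\<sigma> - e))))" .
  qed auto
qed

lemma exp_second_order_bound:
  "norm (exp z - 1 - z) \<le> exp (norm z) * (norm z)\<^sup>2" for z :: complex
proof -
  have "norm (exp z - 1 - z) \<le> exp \<bar>Re z\<bar> * (norm z)\<^sup>2"
    using Taylor_exp[of z 1] by (simp add: power2_eq_square algebra_simps)
  also have "\<dots> \<le> exp (norm z) * (norm z)\<^sup>2"
    by (intro mult_right_mono) (auto simp: abs_Re_le_cmod)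
  finally show ?thesis .
qed

lemma has_sum_diff_complex:
  fixes f g :: "'i \<Rightarrow> complex"
  assumes "(f has_sum a) A" "(g has_sum b) A"
  shows "((\<lambda>i. f i - g i) has_sum (a - b)) A"
  using has_sum_add[OF assms(1), of "\<lambda>i. - g i" "- b"] assms(2) by (simp add: has_sum_uminus)

text \<open>Each exponential is expanded to second order. The remainders are dominated by the terms
  of the twice differentiated series slightly to the left of \<open>s\<close>, so together they are
  \<open>O(|y - s|^2)\<close>.\<close>

lemma gds_has_field_derivative:
  assumes conv: "gds_conv I c l" and s: "Re s > 1"
  shows "(gds I c l has_field_derivative gds I (\<lambda>i. - of_real (l i) * c i) l s) (at s)"
proof -
  define e where "e = (Re s - 1) / 2"
  have e: "e > 0" "Re s - e > 1" using s by (auto simp: e_def field_simps)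
  let ?c1 = "\<lambda>i. - of_real (l i) * c i" and ?c2 = "\<lambda>i. - of_real (l i) * (- of_real (l i) * c i)"
  have pos: "\<And>i. i \<in> I \<Longrightarrow> 0 \<le> l i" using conv by (simp add: gds_conv_def)
  have conv1: "gds_conv I ?c1 l" by (rule gds_conv_deriv[OF conv])
  have conv2: "gds_conv I ?c2 l" by (rule gds_conv_deriv[OF conv1])
  \<comment> \<open>Evaluating at \<open>Re s - e\<close> absorbs the factor
    \<open>exp (l i * e)\<close> of the Taylor remainder for
    \<open>norm (y - s) < e\<close>.\<close>
  define K where "K = (\<Sum>\<^sub>\<infinity>i\<in>I. norm (?c2 i) * exp (- (l i * (Re s - e))))"
  have sumK: "(\<lambda>i. norm (?c2 i) * exp (- (l i * (Re s - e)))) summable_on I"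
    using conv2 e by (simp add: gds_conv_def)
  have bound: "norm (gds I c l y - gds I c l s - gds I ?c1 l s * (y - s)) \<le> K * (norm (y - s))\<^sup>2"
    if y: "norm (y - s) < e" for y
  proof -
    define h where "h = y - s"
    have h: "norm h < e" "y = s + h" using y by (auto simp: h_def)
    have y1: "Re y > 1" using h e abs_Re_le_cmod[of h] by auto
    have S: "((\<lambda>i. c i * exp (- (of_real (l i) * y)) - c i * exp (- (of_real (l i) * s))
             - ?c1 i * exp (- (of_real (l i) * s)) * h) has_sum
             (gds I c l y - gds I c l s - gds I ?c1 l s * h)) I"
      unfolding gds_def
      by (intro has_sum_diff_complex has_sum_cmult_left has_sum_infsum gds_conv_summable conv conv1 s y1)
    have T: "((\<lambda>i. norm (?c2 i) * exp (- (l i * (Re s - e))) * (norm h)\<^sup>2) has_sum (K * (norm h)\<^sup>2)) I"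
      unfolding K_def by (intro has_sum_cmult_left has_sum_infsum sumK)
    show ?thesis unfolding h_def[symmetric]
    proof (rule norm_infsum_le[OF S T])
      fix i assume i: "i \<in> I"
      define z where "z = - (of_real (l i) * h)"
      have nz: "norm z = l i * norm h" using pos[OF i] by (simp add: z_def norm_mult)
      have "c i * exp (- (of_real (l i) * y)) - c i * exp (- (of_real (l i) * s))
             - ?c1 i * exp (- (of_real (l i) * s)) * h
            = c i * exp (- (of_real (l i) * s)) * (exp z - 1 - z)"
        by (simp add: h z_def algebra_simps flip: exp_add)
      also have "norm \<dots> = norm (c i) * exp (- (l i * Re s)) * norm (exp z - 1 - z)"
        by (simp add: norm_mult)
      also have "\<dots> \<le> norm (c i) * exp (- (l i * Re s)) * (exp (l i * e) * (norm z)\<^sup>2)"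
      proof (intro mult_left_mono order.trans[OF exp_second_order_bound] mult_right_mono)
        show "exp (norm z) \<le> exp (l i * e)" using pos[OF i] h unfolding nz
          by (simp add: mult_left_mono)
      qed auto
      also have "\<dots> = norm (?c2 i) * exp (- (l i * (Re s - e))) * (norm h)\<^sup>2"
        unfolding nz using pos[OF i]
        by (simp add: norm_mult exp_diff exp_add exp_minus field_simps power2_eq_square right_diff_distrib)
      finally show "norm (c i * exp (- (of_real (l i) * y)) - c i * exp (- (of_real (l i) * s))
             - ?c1 i * exp (- (of_real (l i) * s)) * h)
          \<le> norm (?c2 i) * exp (- (l i * (Re s - e))) * (norm h)\<^sup>2" .
    qed
  qed
  have "((\<lambda>y. (gds I c l y - gds I c l s) / (y - s)) \<longlongrightarrow> gds I ?c1 l s) (at s)"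
  proof (rule LIM_zero_cancel, rule Lim_null_comparison)
    show "\<forall>\<^sub>F y in at s. norm ((gds I c l y - gds I c l s) / (y - s) - gds I ?c1 l s) \<le> K * norm (y - s)"
      unfolding eventually_at
    proof (intro exI conjI ballI impI)
      fix y assume y: "y \<noteq> s \<and> dist y s < e"
      have "norm ((gds I c l y - gds I c l s) / (y - s) - gds I ?c1 l s)
            = norm (gds I c l y - gds I c l s - gds I ?c1 l s * (y - s)) / norm (y - s)"
        using y by (simp add: field_simps flip: norm_divide)
      also have "\<dots> \<le> K * (norm (y - s))\<^sup>2 / norm (y - s)"
        using y by (intro divide_right_mono bound) (auto simp: dist_norm)
      finally show "norm ((gds I c l y - gds I c l s) / (y - s) - gds I ?c1 l s) \<le> K * norm (y - s)"
        using y by (simp add: power2_eq_square)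
    qed (use e in auto)
    show "((\<lambda>y. K * norm (y - s)) \<longlongrightarrow> 0) (at s)"
      by (auto intro!: tendsto_eq_intros)
  qed
  then show ?thesis by (simp add: has_field_derivative_iff)
qed

lemma gds_holomorphic:
  assumes "gds_conv I c l"
  shows "gds I c l holomorphic_on {s. Re s > 1}"
  using gds_has_field_derivative[OF assms]
  by (intro holomorphic_onI) (auto simp: field_differentiable_def intro: has_field_derivative_at_within)

text \<open>Multiplying by \<open>exp (x s)\<close> with \<open>x\<close> the smallest exponent whose level sum does not vanish
  and letting \<open>s \<rightarrow> \<infinity>\<close> isolates that level sum.\<close>

lemma gds_eq_0_imp_level_sum_eq_0:
  assumes conv: "gds_conv I c l" and fin: "\<And>x. finite {i\<in>I. l i \<le> x}"
    and zero: "\<And>s. Re s > 1 \<Longrightarrow> gds I c l s = 0"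
  shows "(\<Sum>i | i \<in> I \<and> l i = x. c i) = 0"
proof (rule ccontr)
  define A where "A x = (\<Sum>i | i \<in> I \<and> l i = x. c i)" for x
  assume "(\<Sum>i | i \<in> I \<and> l i = x. c i) \<noteq> 0"
  then have x: "A x \<noteq> 0" by (simp add: A_def)
  have Ane: "{i. i \<in> I \<and> l i = y} \<noteq> {}" if "A y \<noteq> 0" for y
  proof
    assume "{i. i \<in> I \<and> l i = y} = {}"
    then have "A y = 0" unfolding A_def by (metis sum.empty)
    with that show False by simp
  qed
  \<comment> \<open>Exponents beyond \<open>x\<close> are discarded, so that the candidates are
    finite in number and a smallest one exists; \<open>x\<close> itself belongs to
    \<open>X\<close>.\<close>
  define X where "X = {y. y \<le> x \<and> A y \<noteq> 0}"
  have "X \<subseteq> l ` {i\<in>I. l i \<le> x}"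
  proof
    fix y assume y: "y \<in> X"
    with Ane have "{i. i \<in> I \<and> l i = y} \<noteq> {}" by (simp add: X_def)
    with y show "y \<in> l ` {i\<in>I. l i \<le> x}" by (auto simp: X_def)
  qed
  then have finX: "finite X" using fin finite_subset by blast
  define m where "m = Min X"
  have mX: "m \<in> X" unfolding m_def using finX x by (intro Min_in) (auto simp: X_def)
  have min: "A y = 0" if "y < m" for y
  proof (rule ccontr)
    assume "A y \<noteq> 0" then have "y \<in> X" using that mX by (auto simp: X_def)
    then show False using finX that unfolding m_def by (meson Min_le linorder_not_less)
  qed
  define lo where "lo = {i\<in>I. l i \<le> m}"
  define hi where "hi = {i\<in>I. l i > m}"
  have I: "I = lo \<union> hi" "lo \<inter> hi = {}" by (auto simp: lo_def hi_def)
  have finlo: "finite lo" unfolding lo_def by (rule fin)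
  \<comment> \<open>Level sums below \<open>m\<close> vanish, so grouping the finitely many terms of
    \<open>lo\<close> by exponent leaves the level \<open>m\<close> alone.\<close>
  have losum: "(\<Sum>i\<in>lo. c i * exp (- (of_real (l i) * s))) = A m * exp (- (of_real m * s))" for s
  proof -
    have "(\<Sum>i\<in>lo. c i * exp (- (of_real (l i) * s)))
        = (\<Sum>y\<in>l ` lo. \<Sum>i | i \<in> lo \<and> l i = y. c i * exp (- (of_real (l i) * s)))"
      by (rule sum.group[symmetric]) (use finlo in auto)
    also have "\<dots> = (\<Sum>y\<in>l ` lo. A y * exp (- (of_real y * s)))"
    proof (rule sum.cong[OF refl])
      fix y assume "y \<in> l ` lo"
      then have "{i. i \<in> lo \<and> l i = y} = {i. i \<in> I \<and> l i = y}" by (auto simp: lo_def)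
      then show "(\<Sum>i | i \<in> lo \<and> l i = y. c i * exp (- (of_real (l i) * s))) = A y * exp (- (of_real y * s))"
        by (simp add: A_def sum_distrib_right)
    qed
    also have "\<dots> = (\<Sum>y\<in>{m}. A y * exp (- (of_real y * s)))"
    proof (rule sum.mono_neutral_right)
      show "{m} \<subseteq> l ` lo"
      proof -
        have "{i. i \<in> I \<and> l i = m} \<noteq> {}" using mX Ane by (simp add: X_def)
        then show ?thesis by (auto simp: lo_def)
      qed
      show "\<forall>y\<in>l ` lo - {m}. A y * exp (- (of_real y * s)) = 0"
      proof
        fix y assume "y \<in> l ` lo - {m}"
        then have "y < m" by (auto simp: lo_def)
        then show "A y * exp (- (of_real y * s)) = 0" using min by simp
      qed
    qed (use finlo in simp)
    finally show ?thesis by simp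
  qed
  \<comment> \<open>Only finitely many indices have exponent at most \<open>m + 1\<close>, so the
    exponents above \<open>m\<close> keep a positive distance from it.\<close>
  have "\<exists>\<mu>>0. \<forall>i\<in>hi. l i \<ge> m + \<mu>"
  proof (cases "{i\<in>I. l i \<le> m + 1} \<inter> hi = {}")
    case True
    then show ?thesis by (intro exI[of _ 1]) (fastforce simp: hi_def)
  next
    case False
    let ?Y = "l ` ({i\<in>I. l i \<le> m + 1} \<inter> hi)"
    have finY: "finite ?Y" using fin by blast
    have "Min ?Y \<in> ?Y" using finY False by (intro Min_in) auto
    then have g: "Min ?Y > m" and g1: "Min ?Y \<le> m + 1" unfolding hi_def by auto
    show ?thesis
    proof (intro exI[of _ "Min ?Y - m"] conjI ballI)
      fix i assume i: "i \<in> hi"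
      show "m + (Min ?Y - m) \<le> l i"
      proof (cases "l i \<le> m + 1")
        case True
        then have "l i \<in> ?Y" using i by (auto simp: hi_def)
        then have "Min ?Y \<le> l i" using finY by (rule Min_le[rotated])
        then show ?thesis by simp
      qed (use g1 in simp)
    qed (use g in simp)
  qed
  then obtain \<mu> where \<mu>: "\<mu> > 0" "\<And>i. i \<in> hi \<Longrightarrow> l i \<ge> m + \<mu>" by blast
  define K where "K = (\<Sum>\<^sub>\<infinity>i\<in>hi. norm (c i) * exp (- (l i * 2)))"
  have convhi: "gds_conv hi c l" using gds_conv_subset[OF conv] by (auto simp: hi_def)
  have sumK: "(\<lambda>i. norm (c i) * exp (- (l i * 2))) summable_on hi"
    using convhi by (simp add: gds_conv_def)
  \<comment> \<open>The terms above \<open>m\<close> are compared with their values at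
    \<open>2\<close>. Passing from \<open>2\<close> to \<open>\<sigma>\<close> gains
    \<open>exp (- ((m + \<mu>) * (\<sigma> - 2)))\<close>, which beats the factor
    \<open>exp (- (m * \<sigma>))\<close> of the level \<open>m\<close>.\<close>
  have est: "norm (A m) \<le> K * exp (2 * m) * exp (- (\<mu> * (\<sigma> - 2)))" if \<sigma>: "\<sigma> \<ge> 2" for \<sigma>
  proof -
    have "gds I c l (of_real \<sigma>) = (\<Sum>\<^sub>\<infinity>i\<in>lo. c i * exp (- (of_real (l i) * of_real \<sigma>))) + gds hi c l (of_real \<sigma>)"
      unfolding gds_def I(1)
      by (rule infsum_Un_disjoint) (use I(2) finlo gds_conv_summable[OF convhi, of "of_real \<sigma>"] \<sigma> in auto)
    also have "(\<Sum>\<^sub>\<infinity>i\<in>lo. c i * exp (- (of_real (l i) * of_real \<sigma>))) = A m * exp (- (of_real m * of_real \<sigma>))"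
      using finlo losum[of "of_real \<sigma>"] by simp
    finally have "A m * exp (- (of_real m * of_real \<sigma>)) = - gds hi c l (of_real \<sigma>)"
      using zero[of "of_real \<sigma>"] \<sigma> by (simp add: eq_neg_iff_add_eq_0)
    then have "norm (A m * exp (- (of_real m * of_real \<sigma>))) = norm (gds hi c l (of_real \<sigma>))" by simp
    then have "norm (A m) * exp (- (m * \<sigma>)) = norm (gds hi c l (of_real \<sigma>))"
      by (simp add: norm_mult)
    also have "\<dots> \<le> K * exp (- ((m + \<mu>) * (\<sigma> - 2)))"
    proof (rule norm_infsum_le)
      show "((\<lambda>i. c i * exp (- (of_real (l i) * of_real \<sigma>))) has_sum gds hi c l (of_real \<sigma>)) hi"
        unfolding gds_def using gds_conv_summable[OF convhi, of "of_real \<sigma>"] \<sigma> by (intro has_sum_infsum) auto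
      show "((\<lambda>i. norm (c i) * exp (- (l i * 2)) * exp (- ((m + \<mu>) * (\<sigma> - 2)))) has_sum
             K * exp (- ((m + \<mu>) * (\<sigma> - 2)))) hi"
        unfolding K_def by (intro has_sum_cmult_left has_sum_infsum sumK)
      fix i assume i: "i \<in> hi"
      have "(m + \<mu>) * (\<sigma> - 2) \<le> l i * (\<sigma> - 2)" using \<mu>(2)[OF i] \<sigma> by (intro mult_right_mono) auto
      then have "exp (- (l i * \<sigma>)) \<le> exp (- (l i * 2)) * exp (- ((m + \<mu>) * (\<sigma> - 2)))"
        unfolding exp_add[symmetric] by (simp add: algebra_simps)
      then have "norm (c i) * exp (- (l i * \<sigma>)) \<le> norm (c i) * (exp (- (l i * 2)) * exp (- ((m + \<mu>) * (\<sigma> - 2))))"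
        by (intro mult_left_mono) auto
      then show "norm (c i * exp (- (of_real (l i) * of_real \<sigma>)))
            \<le> norm (c i) * exp (- (l i * 2)) * exp (- ((m + \<mu>) * (\<sigma> - 2)))"
        by (simp add: norm_mult)
    qed
    finally have "norm (A m) * exp (- (m * \<sigma>)) * exp (m * \<sigma>) \<le> K * exp (- ((m + \<mu>) * (\<sigma> - 2))) * exp (m * \<sigma>)"
      by (intro mult_right_mono) auto
    then show ?thesis by (simp add: mult.assoc algebra_simps flip: exp_add)
  qed
  have "((\<lambda>\<sigma>. K * exp (2 * m) * exp (- (\<mu> * (\<sigma> - 2)))) \<longlongrightarrow> 0) at_top"
  proof -
    have "filterlim (\<lambda>\<sigma>. \<mu> * (\<sigma> - 2)) at_top at_top"
      using \<mu>(1) filterlim_tendsto_add_at_top[OF tendsto_const filterlim_ident, of "- 2 :: real"]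
      by (intro filterlim_tendsto_pos_mult_at_top[OF tendsto_const]) auto
    then have "((\<lambda>\<sigma>. exp (- (\<mu> * (\<sigma> - 2)))) \<longlongrightarrow> 0) at_top"
      by (intro filterlim_compose[OF exp_at_bot]) (simp add: filterlim_uminus_at_bot)
    from tendsto_mult_left[OF this, of "K * exp (2 * m)"] show ?thesis by simp
  qed
  then have "norm (A m) \<le> 0"
    by (rule tendsto_lowerbound) (auto simp: eventually_at_top_linorder intro!: exI[of _ 2] est)
  then show False using mX by (simp add: X_def)
qed

section \<open>Real values of holomorphic functions on a vertical line\<close>

text \<open>Locally \<open>W = V ^ n\<close> with \<open>V\<close> biholomorphic, so the preimage of the reals contains the
  preimages under \<open>V\<close> of the lines of direction \<open>1\<close> and \<open>cis (pi / n)\<close>. Both are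
  contained in one vertical line only if \<open>n = 1\<close>.\<close>

lemma real_values_on_vertical_line:
  assumes hol: "W holomorphic_on U" and U: "open U" "s\<^sub>0 \<in> U" and W0: "W s\<^sub>0 = 0"
    and only: "\<And>s. s \<in> U \<Longrightarrow> W s \<in> \<real> \<Longrightarrow> Re s = Re s\<^sub>0"
  shows "deriv W s\<^sub>0 \<noteq> 0" "Re (deriv W s\<^sub>0) = 0"
    "\<exists>e>0. \<forall>y. \<bar>y - Im s\<^sub>0\<bar> < e \<longrightarrow> Complex (Re s\<^sub>0) y \<in> U \<and> W (Complex (Re s\<^sub>0) y) \<in> \<real>"
proof -
  obtain r0 where r0: "r0 > 0" "ball s\<^sub>0 r0 \<subseteq> U" using U openE by blast
  have holb: "W holomorphic_on ball s\<^sub>0 r0" using hol r0 holomorphic_on_subset by blast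
  \<comment> \<open>If all derivatives of positive order vanished, \<open>W\<close> would be
    constantly \<open>0\<close> on the ball and hence real at points off the line.\<close>
  have "\<exists>n>0. (deriv ^^ n) W s\<^sub>0 \<noteq> 0"
  proof (rule ccontr)
    assume "\<not> (\<exists>n>0. (deriv ^^ n) W s\<^sub>0 \<noteq> 0)"
    then have "(deriv ^^ n) W s\<^sub>0 = 0" if "n > 0" for n using that by blast
    moreover have "s\<^sub>0 + of_real (r0 / 2) \<in> ball s\<^sub>0 r0" using r0 by (simp add: dist_norm)
    ultimately have "W (s\<^sub>0 + of_real (r0 / 2)) = W s\<^sub>0"
      using r0 by (intro holomorphic_fun_eq_const_on_connected[OF holb, of s\<^sub>0 "s\<^sub>0 + of_real (r0 / 2)"]) auto
    then have "Re (s\<^sub>0 + of_real (r0 / 2)) = Re s\<^sub>0"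
      using only[of "s\<^sub>0 + of_real (r0 / 2)"] r0 W0 \<open>s\<^sub>0 + of_real (r0 / 2) \<in> ball s\<^sub>0 r0\<close> by auto
    then show False using r0 by simp
  qed
  then obtain n where n: "n > 0" "(deriv ^^ n) W s\<^sub>0 \<noteq> 0" "\<And>i. 0 < i \<Longrightarrow> i < n \<Longrightarrow> (deriv ^^ i) W s\<^sub>0 = 0"
    using exists_least_iff[of "\<lambda>n. n > 0 \<and> (deriv ^^ n) W s\<^sub>0 \<noteq> 0"] by blast
  obtain g r where r: "r > 0" "g holomorphic_on ball s\<^sub>0 r"
    "\<And>w. w \<in> ball s\<^sub>0 r \<Longrightarrow> W w - W s\<^sub>0 = ((w - s\<^sub>0) * g w) ^ n" "\<And>w. w \<in> ball s\<^sub>0 r \<Longrightarrow> g w \<noteq> 0"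
    using holomorphic_factor_order_of_zero_strong[OF hol U n] by metis
  define V where "V w = (w - s\<^sub>0) * g w" for w
  define r1 where "r1 = min r r0"
  have r1: "r1 > 0" "ball s\<^sub>0 r1 \<subseteq> ball s\<^sub>0 r" "ball s\<^sub>0 r1 \<subseteq> U" using r r0 by (auto simp: r1_def)
  have holg1: "g holomorphic_on ball s\<^sub>0 r1" using r r1 holomorphic_on_subset by blast
  have holV: "V holomorphic_on ball s\<^sub>0 r1" unfolding V_def by (intro holomorphic_intros holg1)
  have "(g has_field_derivative deriv g s\<^sub>0) (at s\<^sub>0)"
    using holg1 r1 by (intro holomorphic_derivI[of _ "ball s\<^sub>0 r1"]) auto
  then have "(V has_field_derivative g s\<^sub>0) (at s\<^sub>0)"
    unfolding V_def by (auto intro!: derivative_eq_intros)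
  then have dV: "deriv V s\<^sub>0 \<noteq> 0" using r by (simp add: DERIV_imp_deriv)
  have V0: "V s\<^sub>0 = 0" by (simp add: V_def)
  obtain r2 where r2: "r2 > 0" "ball s\<^sub>0 r2 \<subseteq> ball s\<^sub>0 r1" "open (V ` ball s\<^sub>0 r2)" "inj_on V (ball s\<^sub>0 r2)"
    using has_complex_derivative_locally_invertible[OF holV _ _ dV] r1 by auto
  obtain k where k: "k holomorphic_on V ` ball s\<^sub>0 r2"
    "\<And>z. z \<in> ball s\<^sub>0 r2 \<Longrightarrow> deriv V z * deriv k (V z) = 1"
    "\<And>z. z \<in> ball s\<^sub>0 r2 \<Longrightarrow> k (V z) = z"
    using holomorphic_has_inverse[OF holomorphic_on_subset[OF holV r2(2)] _ r2(4)] by auto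
  have "0 \<in> V ` ball s\<^sub>0 r2" using V0 r2(1) by (metis centre_in_ball image_eqI)
  then obtain \<rho> where \<rho>: "\<rho> > 0" "ball 0 \<rho> \<subseteq> V ` ball s\<^sub>0 r2" using r2(3) openE by blast
  have kz: "k z \<in> ball s\<^sub>0 r2" "V (k z) = z" if "z \<in> ball 0 \<rho>" for z
    using \<rho>(2) k(3) that by auto
  have kU: "k z \<in> U" if "z \<in> ball 0 \<rho>" for z using kz[OF that] r1 r2 by auto
  have Wk: "W (k z) = z ^ n" if "z \<in> ball 0 \<rho>" for z
  proof -
    have "k z \<in> ball s\<^sub>0 r" using kz(1)[OF that] r1(2) r2(2) by blast
    then show ?thesis using r(3) kz(2)[OF that] W0 by (simp add: V_def)
  qed
  have k0: "k 0 = s\<^sub>0" using k(3)[of s\<^sub>0] V0 r2(1) by simp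
  define d where "d = deriv k 0"
  have Vd: "deriv V s\<^sub>0 * d = 1" using k(2)[of s\<^sub>0] r2(1) V0 by (simp add: d_def)
  have holk: "k holomorphic_on ball 0 \<rho>" using k(1) \<rho>(2) holomorphic_on_subset by blast
  have kd: "(k has_field_derivative d) (at 0)"
    unfolding d_def using \<rho> by (intro holomorphic_derivI[OF holk]) auto
  have kline: "((\<lambda>t. k (of_real t * u)) has_vector_derivative u * d) (at 0)" for u
  proof -
    have "((\<lambda>t. of_real t * u) has_vector_derivative u) (at 0)"
      by (auto intro!: derivative_eq_intros has_vector_derivative_real_field simp: has_vector_derivative_def)
        (auto intro!: derivative_eq_intros simp: scaleR_conv_of_real fun_eq_iff)
    from field_vector_diff_chain_at[OF this, of k d] kd show ?thesis by (simp add: o_def)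
  qed
  have line: "Re (k (of_real t * u)) = Re s\<^sub>0" if "norm u = 1" "u ^ n \<in> \<real>" "\<bar>t\<bar> < \<rho>" for u t
  proof -
    have b: "of_real t * u \<in> ball 0 \<rho>" using that by (simp add: norm_mult)
    show ?thesis using only[OF kU[OF b]] Wk[OF b] that(2) by (simp add: power_mult_distrib)
  qed
  \<comment> \<open>On the line of direction \<open>u\<close>,
    \<open>W (k (t * u)) = t ^ n * u ^ n\<close> is real, so \<open>k\<close> stays on the vertical
    line and its velocity \<open>u * d\<close> has no real part.\<close>
  have zero: "Re (u * d) = 0" if "norm u = 1" "u ^ n \<in> \<real>" for u
  proof (rule DERIV_local_const)
    show "((\<lambda>t. Re (k (of_real t * u))) has_real_derivative Re (u * d)) (at 0)"
      using bounded_linear.has_vector_derivative[OF bounded_linear_Re kline[of u]] by (simp add: has_real_derivative_iff_has_vector_derivative)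
    show "\<rho> > 0" by fact
    show "\<forall>y. \<bar>0 - y\<bar> < \<rho> \<longrightarrow> Re (k (of_real 0 * u)) = Re (k (of_real y * u))"
      using line[OF that, of 0] line[OF that] \<rho>(1) by auto
  qed
  have d0: "Re d = 0" using zero[of 1] by simp
  have dne: "d \<noteq> 0" using Vd by auto
  then have Imd: "Im d \<noteq> 0" using d0 complex_eqI[of d 0] by auto
  \<comment> \<open>As \<open>d\<close> is purely imaginary,
    \<open>Re (cis (pi / n) * d) = - sin (pi / n) * Im d\<close>, and for positive \<open>n\<close>
    the sine vanishes only if \<open>n = 1\<close>.\<close>
  have "cis (pi / n) ^ n = -1" using n(1) by (simp add: Complex.DeMoivre cis_pi)
  then have "Re (cis (pi / n) * d) = 0" by (intro zero) auto
  then have sin0: "sin (pi / n) = 0" using d0 Imd by simp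
  have n1: "n = 1"
  proof (rule ccontr)
    assume "n \<noteq> 1"
    then have "n \<ge> 2" using n(1) by simp
    then have "0 < pi / n" "pi / n < pi" using pi_gt_zero by (auto simp: field_simps)
    then have "sin (pi / n) > 0" by (rule sin_gt_zero)
    with sin0 show False by simp
  qed
  have "deriv W s\<^sub>0 = deriv V s\<^sub>0"
  proof (rule complex_derivative_transform_within_open[of _ "ball s\<^sub>0 r1"])
    show "W holomorphic_on ball s\<^sub>0 r1" using hol r1 holomorphic_on_subset by blast
    show "W w = V w" if "w \<in> ball s\<^sub>0 r1" for w
      using r(3)[of w] that r1 n1 W0 by (auto simp: V_def)
  qed (use holV r1 in auto)
  then have Wd: "deriv W s\<^sub>0 * d = 1" using Vd by simp
  then show "deriv W s\<^sub>0 \<noteq> 0" by auto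
  have "deriv W s\<^sub>0 = inverse d" using Wd by (metis inverse_unique mult.commute)
  then show "Re (deriv W s\<^sub>0) = 0" using d0 by simp
  \<comment> \<open>This sign makes the height \<open>\<psi>\<close> have positive derivative at
    \<open>0\<close>. It then takes values on both sides of \<open>Im s\<^sub>0\<close> and, by the
    intermediate value theorem, fills an interval around it.\<close>
  define \<sigma> where "\<sigma> = sgn (Im d)"
  define \<psi> where "\<psi> t = Im (k (of_real (\<sigma> * t)))" for t
  have \<sigma>: "\<bar>\<sigma>\<bar> = 1" "\<sigma> * Im d > 0" using Imd by (auto simp: \<sigma>_def sgn_if)
  have "(\<psi> has_real_derivative Im (of_real \<sigma> * d)) (at 0)"
    using bounded_linear.has_vector_derivative[OF bounded_linear_Im kline[of "of_real \<sigma>"]]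
    by (simp add: has_real_derivative_iff_has_vector_derivative \<psi>_def[abs_def] mult.commute)
  then have \<psi>d: "(\<psi> has_real_derivative \<sigma> * Im d) (at 0)" by simp
  obtain d1 where d1: "d1 > 0" "\<And>h. 0 < h \<Longrightarrow> h < d1 \<Longrightarrow> \<psi> 0 < \<psi> (0 + h)"
    using DERIV_pos_inc_right[OF \<psi>d \<sigma>(2)] by blast
  obtain d2 where d2: "d2 > 0" "\<And>h. 0 < h \<Longrightarrow> h < d2 \<Longrightarrow> \<psi> (0 - h) < \<psi> 0"
    using DERIV_pos_inc_left[OF \<psi>d \<sigma>(2)] by blast
  define h where "h = min (\<rho> / 2) (min (d1 / 2) (d2 / 2))"
  have h: "h > 0" "h < d1" "h < d2" "h < \<rho>" using d1 d2 \<rho> by (auto simp: h_def)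
  have bnd: "\<psi> (-h) < Im s\<^sub>0" "Im s\<^sub>0 < \<psi> h" using d1(2)[of h] d2(2)[of h] h k0 by (auto simp: \<psi>_def)
  have inball: "of_real (\<sigma> * t) \<in> ball (0::complex) \<rho>" if "-h \<le> t" "t \<le> h" for t
    using that h \<sigma> by (simp add: norm_mult)
  have cont: "continuous_on {-h..h} \<psi>"
    unfolding \<psi>_def
    by (intro continuous_intros continuous_on_compose2[OF holomorphic_on_imp_continuous_on[OF holk]])
       (use inball in auto)
  show "\<exists>e>0. \<forall>y. \<bar>y - Im s\<^sub>0\<bar> < e \<longrightarrow> Complex (Re s\<^sub>0) y \<in> U \<and> W (Complex (Re s\<^sub>0) y) \<in> \<real>"
  proof (intro exI[of _ "min (\<psi> h - Im s\<^sub>0) (Im s\<^sub>0 - \<psi> (-h))"] conjI allI impI)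
    fix y assume y: "\<bar>y - Im s\<^sub>0\<bar> < min (\<psi> h - Im s\<^sub>0) (Im s\<^sub>0 - \<psi> (-h))"
    then obtain t where t: "-h \<le> t" "t \<le> h" "\<psi> t = y"
      using IVT'[of \<psi> "-h" y h] cont h by (auto simp: abs_if split: if_splits)
    have b: "of_real (\<sigma> * t) \<in> ball (0::complex) \<rho>" using inball t by blast
    have "Re (k (of_real (\<sigma> * t))) = Re s\<^sub>0"
      using line[of 1 "\<sigma> * t"] b by (simp add: norm_mult abs_mult)
    then have eq: "Complex (Re s\<^sub>0) y = k (of_real (\<sigma> * t))" using t(3) by (auto simp: \<psi>_def complex_eq_iff)
    show "Complex (Re s\<^sub>0) y \<in> U" using eq kU[OF b] by simp
    show "W (Complex (Re s\<^sub>0) y) \<in> \<real>" using Wk[OF b] eq n1 by simp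
  qed (use bnd in auto)
qed

text \<open>With \<open>g\<close> a local inverse of \<open>f\<close>, the equation becomes
  \<open>s + \<i> * x = g (- Q s)\<close>, so the required shift is the holomorphic function
  \<open>W s = - \<i> * (g (- Q s) - s)\<close>. A real value of \<open>W\<close> yields a zero for
  a real shift; thus \<open>W\<close> is real only on the line, and the preceding lemma
  applies.\<close>

lemma zeros_of_vertical_shifts_on_line:
  assumes r: "r > 0" and holQ: "Q holomorphic_on ball s\<^sub>0 r" and holf: "f holomorphic_on ball s\<^sub>0 r"
    and zero: "Q s\<^sub>0 + f s\<^sub>0 = 0" and df: "deriv f s\<^sub>0 \<noteq> 0"
    and only: "\<And>s x. s \<in> ball s\<^sub>0 r \<Longrightarrow> s + \<i> * of_real x \<in> ball s\<^sub>0 r \<Longrightarrow>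
                 Q s + f (s + \<i> * of_real x) = 0 \<Longrightarrow> Re s = Re s\<^sub>0"
  shows "deriv Q s\<^sub>0 + deriv f s\<^sub>0 \<noteq> 0" "deriv f s\<^sub>0 / (deriv Q s\<^sub>0 + deriv f s\<^sub>0) \<in> \<real>"
    "\<exists>e>0. \<forall>y. \<bar>y - Im s\<^sub>0\<bar> < e \<longrightarrow>
       (\<exists>x. Q (Complex (Re s\<^sub>0) y) + f (Complex (Re s\<^sub>0) y + \<i> * of_real x) = 0)"
proof -
  obtain r' where r': "r' > 0" "ball s\<^sub>0 r' \<subseteq> ball s\<^sub>0 r" "open (f ` ball s\<^sub>0 r')" "inj_on f (ball s\<^sub>0 r')"
    using has_complex_derivative_locally_invertible[OF holf _ _ df] r by auto
  obtain g where g: "g holomorphic_on f ` ball s\<^sub>0 r'"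
    "\<And>z. z \<in> ball s\<^sub>0 r' \<Longrightarrow> deriv f z * deriv g (f z) = 1"
    "\<And>z. z \<in> ball s\<^sub>0 r' \<Longrightarrow> g (f z) = z"
    using holomorphic_has_inverse[OF holomorphic_on_subset[OF holf r'(2)] _ r'(4)] by auto
  have holmQ: "(\<lambda>s. - Q s) holomorphic_on ball s\<^sub>0 r" by (intro holomorphic_intros holQ)
  define U where "U = ball s\<^sub>0 r \<inter> (\<lambda>s. - Q s) -` (f ` ball s\<^sub>0 r')"
  have "open U" unfolding U_def
    using holmQ r'(3) by (intro continuous_open_preimage holomorphic_on_imp_continuous_on) auto
  have mQ0: "- Q s\<^sub>0 = f s\<^sub>0" using zero by (metis minus_unique)
  have s0U: "s\<^sub>0 \<in> U" using r r' mQ0 by (auto simp: U_def)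
  define W where "W s = - \<i> * (g (- Q s) - s)" for s
  have holW: "W holomorphic_on U" unfolding W_def
  proof (intro holomorphic_intros)
    show "(\<lambda>s. g (- Q s)) holomorphic_on U"
      using holomorphic_on_compose_gen[OF holomorphic_on_subset[OF holmQ] g(1), of U]
      by (auto simp: o_def U_def)
  qed
  have W0: "W s\<^sub>0 = 0" using g(3)[of s\<^sub>0] r' by (simp add: W_def mQ0)
  have sol: "s + \<i> * of_real x \<in> ball s\<^sub>0 r'" "Q s + f (s + \<i> * of_real x) = 0"
    if "s \<in> U" "W s = of_real x" for s x
  proof -
    have eq: "g (- Q s) = s + \<i> * of_real x" using that(2) unfolding W_def
      by (metis (no_types, opaque_lifting) add.commute diff_add_cancel i_squared minus_mult_left mult.assoc mult_1 mult_minus_left minus_minus)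
    have "- Q s \<in> f ` ball s\<^sub>0 r'" using that(1) by (simp add: U_def)
    then obtain z where z: "z \<in> ball s\<^sub>0 r'" "- Q s = f z" by blast
    have "z = s + \<i> * of_real x" using z g(3) eq by metis
    then show "s + \<i> * of_real x \<in> ball s\<^sub>0 r'" "Q s + f (s + \<i> * of_real x) = 0"
      using z by (auto simp: neg_eq_iff_add_eq_0)
  qed
  have "Re s = Re s\<^sub>0" if s: "s \<in> U" "W s \<in> \<real>" for s
  proof -
    obtain x where "W s = of_real x" using s(2) by (auto elim: Reals_cases)
    from sol[OF s(1) this] show ?thesis using only r'(2) s(1) by (auto simp: U_def)
  qed
  note A = real_values_on_vertical_line[OF holW \<open>open U\<close> s0U W0 this]
  have dg: "(g has_field_derivative deriv g (f s\<^sub>0)) (at (- Q s\<^sub>0))"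
    unfolding mQ0 using r'(1) by (intro holomorphic_derivI[OF g(1) r'(3)]) auto
  have dQ: "((\<lambda>s. - Q s) has_field_derivative - deriv Q s\<^sub>0) (at s\<^sub>0)"
    using r by (intro derivative_intros holomorphic_derivI[OF holQ]) auto
  have "(W has_field_derivative - \<i> * (deriv g (f s\<^sub>0) * (- deriv Q s\<^sub>0) - 1)) (at s\<^sub>0)"
    unfolding W_def using DERIV_chain2[OF dg dQ] by (auto intro!: derivative_eq_intros)
  moreover have "deriv g (f s\<^sub>0) = 1 / deriv f s\<^sub>0" using g(2)[of s\<^sub>0] r' df by (auto simp: field_simps)
  \<comment> \<open>A vanishing real part of this derivative means that
    \<open>(Q' + f') / f'\<close> is real.\<close>
  ultimately have dW: "deriv W s\<^sub>0 = \<i> * ((deriv Q s\<^sub>0 + deriv f s\<^sub>0) / deriv f s\<^sub>0)"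
    using df by (auto dest!: DERIV_imp_deriv simp: field_simps)
  show ne: "deriv Q s\<^sub>0 + deriv f s\<^sub>0 \<noteq> 0" using A(1) dW by auto
  have "Im ((deriv Q s\<^sub>0 + deriv f s\<^sub>0) / deriv f s\<^sub>0) = 0" using A(2) unfolding dW Re_i_times by simp
  then have "(deriv Q s\<^sub>0 + deriv f s\<^sub>0) / deriv f s\<^sub>0 \<in> \<real>" by (simp add: complex_is_Real_iff)
  then have "inverse ((deriv Q s\<^sub>0 + deriv f s\<^sub>0) / deriv f s\<^sub>0) \<in> \<real>" by (rule Reals_inverse)
  then show "deriv f s\<^sub>0 / (deriv Q s\<^sub>0 + deriv f s\<^sub>0) \<in> \<real>" by simp
  obtain e where e: "e > 0" "\<And>y. \<bar>y - Im s\<^sub>0\<bar> < e \<Longrightarrow> Complex (Re s\<^sub>0) y \<in> U \<and> W (Complex (Re s\<^sub>0) y) \<in> \<real>"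
    using A(3) by blast
  show "\<exists>e>0. \<forall>y. \<bar>y - Im s\<^sub>0\<bar> < e \<longrightarrow>
       (\<exists>x. Q (Complex (Re s\<^sub>0) y) + f (Complex (Re s\<^sub>0) y + \<i> * of_real x) = 0)"
    using e sol(2) by (metis Reals_cases)
qed

section \<open>Kronecker approximation for the logarithms of primes\<close>

text \<open>Separating positive and negative coefficients turns the relation into an equality of two
  products of prime powers. Unique factorization gives \<open>nat (u p) = nat (- u p)\<close>, which
  forces both to be \<open>0\<close>.\<close>

lemma primes_ln_independent:
  fixes u :: "nat \<Rightarrow> int"
  assumes P: "finite P" "\<And>p. p \<in> P \<Longrightarrow> prime p" and zero: "(\<Sum>p\<in>P. of_int (u p) * ln (real p)) = 0"
    and p: "p \<in> P"
  shows "u p = 0"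
proof -
  have lnprod: "ln (real (\<Prod>q\<in>P. q ^ e q)) = (\<Sum>q\<in>P. real (e q) * ln (real q))" for e
    using P by (simp add: ln_prod ln_realpow prime_gt_0_nat)
  have "(\<Sum>q\<in>P. real (nat (u q)) * ln (real q)) - (\<Sum>q\<in>P. real (nat (- u q)) * ln (real q)) = 0"
    unfolding zero[symmetric] sum_subtractf[symmetric] left_diff_distrib[symmetric]
    by (intro sum.cong) auto
  then have "ln (real (\<Prod>q\<in>P. q ^ nat (u q))) = ln (real (\<Prod>q\<in>P. q ^ nat (- u q)))"
    unfolding lnprod by simp
  moreover have pos: "real (\<Prod>q\<in>P. q ^ e q) > 0" for e
    unfolding of_nat_0_less_iff using P(2) by (intro prod_pos) (auto simp: prime_gt_0_nat)
  ultimately have "real (\<Prod>q\<in>P. q ^ nat (u q)) = real (\<Prod>q\<in>P. q ^ nat (- u q))"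
    using ln_inj_iff[OF pos[of "\<lambda>q. nat (u q)"] pos[of "\<lambda>q. nat (- u q)"]] by blast
  then have "(\<Prod>q\<in>P. q ^ nat (u q)) = (\<Prod>q\<in>P. q ^ nat (- u q))"
    by (rule of_nat_eq_iff[THEN iffD1])
  then have "multiplicity p (\<Prod>q\<in>P. q ^ nat (u q)) = multiplicity p (\<Prod>q\<in>P. q ^ nat (- u q))"
    by simp
  then have "nat (u p) = nat (- u p)"
    using P p by (simp add: multiplicity_prod_prime_powers)
  then show ?thesis by auto
qed

lemma norm_exp_i_diff_le: "norm (exp (\<i> * of_real x) - exp (\<i> * of_real y)) \<le> \<bar>x - y\<bar>"
proof -
  have "exp (\<i> * of_real x) - exp (\<i> * of_real y) = exp (\<i> * of_real y) * (exp (\<i> * of_real (x - y)) - 1)"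
    by (simp add: algebra_simps flip: exp_add)
  also have "norm \<dots> = 2 * \<bar>sin ((x - y) / 2)\<bar>"
    unfolding norm_mult dist_exp_i_1 by simp
  also have "\<dots> \<le> 2 * \<bar>(x - y) / 2\<bar>" by (intro mult_left_mono abs_sin_x_le_abs_x) auto
  finally show ?thesis by simp
qed

text \<open>The phases are close once \<open>t * ln p / (2 * pi)\<close> is close to
  \<open>w p * ln p / (2 * pi)\<close> modulo the integers. Kronecker's theorem achieves this for
  finitely many primes at once, their logarithms being linearly independent over the
  integers.\<close>

lemma exists_common_twist:
  fixes w :: "nat \<Rightarrow> real"
  assumes \<epsilon>: "\<epsilon> > 0"
  shows "\<exists>t. \<forall>p. prime p \<and> p \<le> N \<longrightarrow>
    norm (exp (- (\<i> * of_real (ln (real p) * t))) - exp (- (\<i> * of_real (ln (real p) * w p)))) \<le> \<epsilon>"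
proof -
  define P where "P = {p::nat. prime p \<and> p \<le> N}"
  have finP: "finite P" unfolding P_def by simp
  have Pp: "prime p" if "p \<in> P" for p using that by (simp add: P_def)
  obtain q where q: "bij_betw q {0..<card P} P" using ex_bij_betw_nat_finite[OF finP] by blast
  define n where "n = card P"
  have q: "inj_on q {..<n}" "q ` {..<n} = P"
    using q by (auto simp: bij_betw_def n_def atLeast0LessThan)
  define f where "f p = ln (real p) / (2 * pi)" for p :: nat
  have injf: "inj_on f P"
    by (intro inj_onI) (use Pp in \<open>auto simp: f_def prime_gt_0_nat\<close>)
  \<comment> \<open>Independence is meant over the integers, with the reals as a module over
    them.\<close>
  interpret Modules.module "(\<lambda>r. (*) (real_of_int r))"
    by (simp add: Modules.module.intro distrib_left mult.commute)
  have ind: "independent ((f \<circ> q) ` {..<n})"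
    unfolding dependent_explicit
  proof (safe)
    fix T u v assume T: "finite T" "T \<subseteq> (f \<circ> q) ` {..<n}" and z: "(\<Sum>v\<in>T. real_of_int (u v) * v) = 0"
      and v: "v \<in> T" "u v \<noteq> 0"
    define S where "S = {p \<in> P. f p \<in> T}"
    have TS: "T = f ` S" using T(2) unfolding S_def image_comp[symmetric] q(2) by blast
    have injS: "inj_on f S" using injf by (rule inj_on_subset) (auto simp: S_def)
    have "(\<Sum>p\<in>S. real_of_int (u (f p)) * f p) = 0"
      using z unfolding TS by (simp add: sum.reindex[OF injS] o_def)
    then have "(\<Sum>p\<in>S. real_of_int (u (f p)) * ln (real p)) / (2 * pi) = 0"
      by (simp add: f_def sum_divide_distrib)
    then have "(\<Sum>p\<in>S. real_of_int (u (f p)) * ln (real p)) = 0" by simp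
    then have "u (f p) = 0" if "p \<in> S" for p
      using that finP by (intro primes_ln_independent[of S "\<lambda>p. u (f p)"]) (auto simp: S_def Pp)
    then show False using v TS by auto
  qed
  have injfq: "inj_on (f \<circ> q) {..<n}" using q injf by (simp add: comp_inj_on)
  have "\<epsilon> / (2 * pi) > 0" using \<epsilon> by simp
  from Kronecker_thm_1[OF ind injfq this, of "\<lambda>i. f (q i) * w (q i)"]
  obtain t h where th: "\<And>i. i < n \<Longrightarrow> \<bar>t * (f \<circ> q) i - of_int (h i) - f (q i) * w (q i)\<bar> < \<epsilon> / (2 * pi)"
    by blast
  show ?thesis
  proof (intro exI[of _ t] allI impI)
    fix p assume "prime p \<and> p \<le> N"
    then obtain i where i: "i < n" "p = q i" using q(2) by (auto simp: P_def)
    \<comment> \<open>The integer \<open>h i\<close> contributes a full multiple of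
      \<open>2 * pi\<close>. Inserting it makes the difference of the exponents small, so that the
      linear estimate applies.\<close>
    have eq: "exp (- (\<i> * of_real (ln (real p) * t))) = exp (\<i> * of_real (2 * pi * of_int (h i) - ln (real p) * t))"
      by (auto simp: exp_eq algebra_simps intro!: exI[of _ "- h i"])
    have "norm (exp (- (\<i> * of_real (ln (real p) * t))) - exp (- (\<i> * of_real (ln (real p) * w p))))
        = norm (exp (\<i> * of_real (2 * pi * of_int (h i) - ln (real p) * t)) - exp (\<i> * of_real (- (ln (real p) * w p))))"
      unfolding eq by simp
    also have "\<dots> \<le> \<bar>2 * pi * of_int (h i) - ln (real p) * t - (- (ln (real p) * w p))\<bar>"
      by (rule norm_exp_i_diff_le)
    also have "\<dots> = 2 * pi * \<bar>t * (f \<circ> q) i - of_int (h i) - f (q i) * w (q i)\<bar>"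
    proof -
      have "2 * pi * of_int (h i) - ln (real p) * t - (- (ln (real p) * w p))
          = - (2 * pi * (t * (f \<circ> q) i - of_int (h i) - f (q i) * w (q i)))"
        using pi_neq_zero by (simp add: f_def i(2) right_diff_distrib mult.commute)
      then show ?thesis by (simp only: abs_minus_cancel abs_mult) simp
    qed
    also have "\<dots> \<le> 2 * pi * (\<epsilon> / (2 * pi))" using th[OF i(1)] by (intro mult_left_mono) auto
    finally show "norm (exp (- (\<i> * of_real (ln (real p) * t))) - exp (- (\<i> * of_real (ln (real p) * w p)))) \<le> \<epsilon>"
      by simp
  qed
qed

section \<open>Twists of the logarithm\<close>

definition prime_powers :: "(nat \<times> nat) set" where
  "prime_powers = {p. prime p} \<times> {1..}"

definition log_power :: "nat \<times> nat \<Rightarrow> real" where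
  "log_power pk = real (snd pk) * ln (real (fst pk))"

text \<open>The unimodular number \<open>p^(- \<i> k w_p)\<close>: all powers of one prime share one
  shift.\<close>

definition twist :: "(nat \<Rightarrow> real) \<Rightarrow> nat \<times> nat \<Rightarrow> complex" where
  "twist w pk = exp (- (\<i> * of_real (log_power pk * w (fst pk))))"

text \<open>The series \<open>log F\<close> with \<open>s\<close> replaced by \<open>s + \<i> * w p\<close> in the Euler factor at \<open>p\<close>.\<close>

definition twisted_log :: "(nat \<Rightarrow> complex) \<Rightarrow> (nat \<Rightarrow> real) \<Rightarrow> complex \<Rightarrow> complex" where
  "twisted_log b w = gds prime_powers (\<lambda>pk. twist w pk * b (fst pk ^ snd pk)) log_power"

abbreviation log_conv :: "(nat \<Rightarrow> complex) \<Rightarrow> bool" where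
  "log_conv b \<equiv> gds_conv prime_powers (\<lambda>pk. b (fst pk ^ snd pk)) log_power"

text \<open>The logarithm of the untwisted Euler factor at \<open>p\<close>; a twist enters only as
  a vertical shift of its argument.\<close>

definition log_factor :: "(nat \<Rightarrow> complex) \<Rightarrow> nat \<Rightarrow> complex \<Rightarrow> complex" where
  "log_factor b p = gds {1..} (\<lambda>k. b (p ^ k)) (\<lambda>k. real k * ln (real p))"

lemma norm_twist [simp]: "norm (twist w pk) = 1"
  by (simp add: twist_def)

lemma log_power_nonneg: "pk \<in> prime_powers \<Longrightarrow> 0 \<le> log_power pk"
  by (auto simp: prime_powers_def log_power_def prime_ge_1_nat Suc_leI prime_gt_0_nat)

lemma log_power_eq_ln: "pk \<in> prime_powers \<Longrightarrow> log_power pk = ln (real (fst pk ^ snd pk))"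
  by (auto simp: prime_powers_def log_power_def ln_realpow prime_gt_0_nat)

lemma prime_power_term_eq:
  assumes "pk \<in> prime_powers"
  shows "prime_power_term b s pk = b (fst pk ^ snd pk) * exp (- (of_real (log_power pk) * s))"
proof -
  obtain p k where pk: "pk = (p, k)" by (cases pk)
  then have "p > 0" using assms by (auto simp: prime_powers_def prime_gt_0_nat)
  then show ?thesis
    by (simp add: pk prime_power_term_def log_power_def powr_def Ln_of_nat algebra_simps)
qed

lemma log_dirichlet_series_eq: "log_dirichlet_series b = twisted_log b (\<lambda>_. 0)"
proof
  fix s show "log_dirichlet_series b s = twisted_log b (\<lambda>_. 0) s"
    unfolding log_dirichlet_series_def twisted_log_def gds_def prime_powers_def[symmetric]
    by (intro infsum_cong) (simp add: prime_power_term_eq twist_def)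
qed

lemma cond_II_imp_log_conv:
  assumes "cond_II a b"
  shows "log_conv b"
  unfolding gds_conv_def
proof (intro conjI ballI allI impI)
  fix \<sigma> :: real assume "\<sigma> > 1"
  then have "(\<lambda>pk. norm (prime_power_term b (of_real \<sigma>) pk)) summable_on prime_powers"
    using assms unfolding cond_II_def prime_powers_def by simp
  then show "(\<lambda>pk. norm (b (fst pk ^ snd pk)) * exp (- (log_power pk * \<sigma>))) summable_on prime_powers"
    by (rule summable_on_cong[THEN iffD1, rotated]) (simp add: prime_power_term_eq norm_mult)
qed (rule log_power_nonneg)

lemma twisted_log_conv:
  assumes "log_conv b"
  shows "gds_conv prime_powers (\<lambda>pk. twist w pk * b (fst pk ^ snd pk)) log_power"
  by (rule gds_conv_bounded_mult[OF assms, of _ 1]) simp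

lemma twisted_log_holomorphic:
  "log_conv b \<Longrightarrow> twisted_log b w holomorphic_on {s. Re s > 1}"
  unfolding twisted_log_def by (intro gds_holomorphic twisted_log_conv)

lemma log_factor_conv:
  assumes "log_conv b" "prime p"
  shows "gds_conv {1..} (\<lambda>k. b (p ^ k)) (\<lambda>k. real k * ln (real p))"
  using gds_conv_reindex[OF assms(1), of "Pair p" "{1..}"] assms(2)
  by (force simp: prime_powers_def log_power_def o_def inj_on_def)

text \<open>Vertical translates are the twists by constants, so comparing a translate with any twist
  amounts to comparing their unimodular coefficients.\<close>

lemma twisted_log_translate: "twisted_log b w (s + \<i> * of_real t) = twisted_log b (\<lambda>p. w p + t) s"
  unfolding twisted_log_def gds_def
  by (intro infsum_cong) (simp add: twist_def algebra_simps flip: exp_add)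

lemma twisted_log_remove:
  assumes conv: "log_conv b" and p: "prime p" and s: "Re s > 1"
  shows "twisted_log b w s = log_factor b p (s + \<i> * of_real (w p)) +
     gds (prime_powers - {p} \<times> {1..}) (\<lambda>pk. twist w pk * b (fst pk ^ snd pk)) log_power s"
proof -
  let ?t = "\<lambda>pk. twist w pk * b (fst pk ^ snd pk) * exp (- (of_real (log_power pk) * s))"
  have sub: "{p} \<times> {1..} \<subseteq> prime_powers" using p by (auto simp: prime_powers_def)
  have c1: "?t summable_on {p} \<times> {1..}" "?t summable_on (prime_powers - {p} \<times> {1..})"
    using gds_conv_summable[OF gds_conv_subset[OF twisted_log_conv[OF conv]] s] sub by auto
  have "twisted_log b w s = infsum ?t ({p} \<times> {1..} \<union> (prime_powers - {p} \<times> {1..}))"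
    unfolding twisted_log_def gds_def
    by (rule arg_cong[of _ _ "infsum ?t"]) (use sub in blast)
  also have "\<dots> = infsum ?t ({p} \<times> {1..}) + infsum ?t (prime_powers - {p} \<times> {1..})"
    by (rule infsum_Un_disjoint[OF c1]) auto
  also have "infsum ?t ({p} \<times> {1..}) = infsum ?t (Pair p ` {1..})"
    by (rule arg_cong[of _ _ "infsum ?t"]) auto
  also have "\<dots> = log_factor b p (s + \<i> * of_real (w p))"
    unfolding log_factor_def gds_def
    by (subst infsum_reindex) (auto simp: inj_on_def twist_def log_power_def algebra_simps simp flip: exp_add intro!: infsum_cong)
  finally show ?thesis unfolding gds_def .
qed

text \<open>Only the Euler factor at \<open>p\<close> depends on \<open>w p\<close>, so changing
  this number moves the argument of a single summand and fixes the rest.\<close>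

lemma twisted_log_upd:
  assumes conv: "log_conv b" and p: "prime p" and s: "Re s > 1"
  shows "twisted_log b (w(p := x)) s =
    twisted_log b w s - log_factor b p (s + \<i> * of_real (w p)) + log_factor b p (s + \<i> * of_real x)"
proof -
  have "gds (prime_powers - {p} \<times> {1..}) (\<lambda>pk. twist (w(p := x)) pk * b (fst pk ^ snd pk)) log_power s
      = gds (prime_powers - {p} \<times> {1..}) (\<lambda>pk. twist w pk * b (fst pk ^ snd pk)) log_power s"
    unfolding gds_def by (intro infsum_cong) (auto simp: prime_powers_def twist_def)
  then show ?thesis
    using twisted_log_remove[OF conv p s, of w] twisted_log_remove[OF conv p s, of "w(p := x)"] by simp
qed

section \<open>Frequencies of prime powers and non-constancy of twists\<close>

lemma finite_log_power_le: "finite {pk \<in> prime_powers. log_power pk \<le> x}"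
proof (rule finite_subset)
  show "{pk \<in> prime_powers. log_power pk \<le> x} \<subseteq> {..nat \<lceil>exp x\<rceil>} \<times> {..nat \<lceil>exp x\<rceil>}"
  proof
    fix pk assume pk: "pk \<in> {pk \<in> prime_powers. log_power pk \<le> x}"
    obtain p k where eq: "pk = (p, k)" by (cases pk)
    have p: "p \<ge> 2" "k \<ge> 1" using pk by (auto simp: eq prime_powers_def prime_ge_2_nat)
    have "ln (real (p ^ k)) \<le> x" using pk log_power_eq_ln[of "(p, k)"] by (simp add: eq)
    then have "exp (ln (real (p ^ k))) \<le> exp x" by simp
    moreover have "real (p ^ k) > 0" using p by simp
    ultimately have "real (p ^ k) \<le> exp x" by (simp only: exp_ln)
    then have "p ^ k \<le> nat \<lceil>exp x\<rceil>" by linarith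
    moreover have "p \<le> p ^ k" using p by (simp add: self_le_power)
    moreover have "k \<le> p ^ k"
    proof -
      have "k \<le> 2 ^ k" by (rule less_imp_le) (rule less_exp)
      also have "\<dots> \<le> p ^ k" using p by (intro power_mono) auto
      finally show ?thesis .
    qed
    ultimately show "pk \<in> {..nat \<lceil>exp x\<rceil>} \<times> {..nat \<lceil>exp x\<rceil>}" by (auto simp: eq)
  qed
qed simp

text \<open>A prime is not a proper power, so the level at \<open>ln q\<close> consists of a single
  index and cannot suffer cancellation.\<close>

lemma log_power_eq_ln_prime_iff:
  assumes "pk \<in> prime_powers" "prime q"
  shows "log_power pk = ln (real q) \<longleftrightarrow> pk = (q, 1)"
proof
  assume eq: "log_power pk = ln (real q)"
  have "fst pk ^ snd pk > 0" using assms by (auto simp: prime_powers_def prime_gt_0_nat)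
  moreover have "ln (real (fst pk ^ snd pk)) = ln (real q)" using eq assms by (simp only: log_power_eq_ln)
  ultimately have e: "fst pk ^ snd pk = q"
    using ln_inj_iff[of "real (fst pk ^ snd pk)" "real q"] prime_gt_0_nat[OF assms(2)] by (simp only: of_nat_0_less_iff of_nat_eq_iff)
  then have "snd pk = 1" using assms(2) by (metis prime_power_iff)
  with e show "pk = (q, 1)" by (metis power_one_right prod.collapse)
qed (simp add: log_power_def)

text \<open>If the twist were constant on \<open>S\<close>, its derivative would vanish there and,
  by analytic continuation, on the whole half-plane. But the level sum of the derivative at
  \<open>ln p\<close> is the single nonzero coefficient at \<open>(p, 1)\<close>. Hurwitz's theorem
  requires this non-constancy.\<close>

lemma twisted_log_not_constant:
  assumes conv: "log_conv b" and p: "prime p" "b p \<noteq> 0"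
    and S: "open S" "S \<noteq> {}" "S \<subseteq> {s. Re s > 1}"
  shows "\<not> twisted_log b w constant_on S"
proof
  assume "twisted_log b w constant_on S"
  then obtain c where c: "\<And>s. s \<in> S \<Longrightarrow> twisted_log b w s = c" by (auto simp: constant_on_def)
  let ?c = "\<lambda>pk. - of_real (log_power pk) * (twist w pk * b (fst pk ^ snd pk))"
  note convw = twisted_log_conv[OF conv, of w]
  have conv': "gds_conv prime_powers ?c log_power" by (rule gds_conv_deriv[OF convw])
  have "gds prime_powers ?c log_power s = 0" if s: "Re s > 1" for s
  proof (rule analytic_continuation_open[of S "{s. Re s > 1}" "gds prime_powers ?c log_power" "\<lambda>_. 0"])
    show "connected {s. Re s > 1}" by (intro convex_connected convex_halfspace_Re_gt)
    fix z assume z: "z \<in> S"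
    have "(twisted_log b w has_field_derivative gds prime_powers ?c log_power z) (at z)"
      unfolding twisted_log_def using z S by (intro gds_has_field_derivative[OF convw]) auto
    moreover have "(twisted_log b w has_field_derivative 0) (at z)"
      by (rule has_field_derivative_transform_within_open[of "\<lambda>_. c", OF _ S(1) z]) (auto simp: c)
    ultimately show "gds prime_powers ?c log_power z = 0" by (rule DERIV_unique)
  qed (use S s gds_holomorphic[OF conv'] open_halfspace_Re_gt in auto)
  then have "(\<Sum>pk | pk \<in> prime_powers \<and> log_power pk = ln (real p). ?c pk) = 0"
    by (intro gds_eq_0_imp_level_sum_eq_0[OF conv' finite_log_power_le])
  also have "{pk. pk \<in> prime_powers \<and> log_power pk = ln (real p)} = {(p, 1)}"
    using p(1) log_power_eq_ln_prime_iff[OF _ p(1)] by (auto simp: prime_powers_def log_power_def)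
  finally have "ln (real p) = 0 \<or> twist w (p, 1) = 0" using p(2) by (simp add: log_power_def)
  moreover have "twist w (p, 1) \<noteq> 0" by (simp add: twist_def)
  ultimately show False using prime_gt_1_nat[OF p(1)] by simp
qed

section \<open>Twists as uniform limits of vertical translates\<close>

lemma twist_eq_power: "twist w (p, k) = exp (- (\<i> * of_real (ln (real p) * w p))) ^ k"
  by (simp add: twist_def log_power_def mult_ac flip: exp_of_nat_mult)

text \<open>The summable majorant \<open>M\<close> serves all \<open>s\<close> with
  \<open>Re s \<ge> \<sigma>\<close>, so the terms outside a finite set \<open>F\<close> are
  negligible uniformly in \<open>s\<close>. On \<open>F\<close>, Kronecker's theorem aligns the
  coefficients.\<close>

lemma exists_translate_near_twisted_log:
  assumes conv: "log_conv b" and \<sigma>: "\<sigma> > 1" and \<epsilon>: "\<epsilon> > 0"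
  shows "\<exists>t. \<forall>s. Re s \<ge> \<sigma> \<longrightarrow> norm (twisted_log b (\<lambda>_. 0) (s + \<i> * of_real t) - twisted_log b w s) \<le> \<epsilon>"
proof -
  define M where "M pk = norm (b (fst pk ^ snd pk)) * exp (- (log_power pk * \<sigma>))" for pk
  have M0: "M pk \<ge> 0" for pk by (simp add: M_def)
  have sumM: "M summable_on prime_powers" using conv \<sigma> unfolding M_def gds_conv_def by blast
  obtain F where F: "finite F" "F \<subseteq> prime_powers" "dist (sum M F) (infsum M prime_powers) \<le> \<epsilon> / 4"
    using has_sum_finite_approximation[OF has_sum_infsum[OF sumM], of "\<epsilon> / 4"] \<epsilon> by auto
  have sumT: "M summable_on (prime_powers - F)" using sumM summable_on_subset_banach by blast
  have "infsum M (F \<union> (prime_powers - F)) = infsum M F + infsum M (prime_powers - F)"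
    using F sumT by (intro infsum_Un_disjoint) auto
  then have tail: "infsum M (prime_powers - F) \<le> \<epsilon> / 4"
    using F by (simp add: Un_absorb1 dist_real_def)
  \<comment> \<open>\<open>N\<close> bounds the primes in \<open>F\<close>, which are handed to
    Kronecker's theorem, and also the exponents, which measure the loss in passing to
    \<open>k\<close>-th powers. The inserted \<open>0\<close> covers empty \<open>F\<close>.\<close>
  define N where "N = Max (insert 0 (fst ` F \<union> snd ` F))"
  have N: "fst pk \<le> N" "snd pk \<le> N" if "pk \<in> F" for pk
    using that F(1) by (auto simp: N_def intro!: Max_ge)
  \<comment> \<open>Chosen so that \<open>F\<close> contributes at most
    \<open>\<epsilon> / 2\<close>; the tail adds at most \<open>2 * (\<epsilon> / 4)\<close>, as two
    unimodular numbers differ by at most \<open>2\<close>. The added ones prevent division by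
    zero.\<close>
  define \<delta> where "\<delta> = \<epsilon> / (2 * (real N + 1) * (sum M F + 1))"
  have SF: "sum M F \<ge> 0" by (intro sum_nonneg M0)
  have \<delta>: "\<delta> > 0" using \<epsilon> SF by (simp add: \<delta>_def)
  obtain t where t: "\<And>p. prime p \<Longrightarrow> p \<le> N \<Longrightarrow>
    norm (exp (- (\<i> * of_real (ln (real p) * t))) - exp (- (\<i> * of_real (ln (real p) * w p)))) \<le> \<delta>"
    using exists_common_twist[OF \<delta>] by blast
  have tw: "norm (twist (\<lambda>_. t) pk - twist w pk) \<le> real N * \<delta>" if "pk \<in> F" for pk
  proof -
    obtain p k where eq: "pk = (p, k)" by (cases pk)
    have p: "prime p" "p \<le> N" "k \<le> N" using that F(2) N[OF that] by (auto simp: eq prime_powers_def)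
    have "norm (twist (\<lambda>_. t) pk - twist w pk) \<le> real k *
      norm (exp (- (\<i> * of_real (ln (real p) * t))) - exp (- (\<i> * of_real (ln (real p) * w p))))"
      unfolding eq twist_eq_power by (intro norm_power_diff) auto
    also have "\<dots> \<le> real N * \<delta>" using p t by (intro mult_mono) auto
    finally show ?thesis .
  qed
  show ?thesis
  proof (intro exI[of _ t] allI impI)
    fix s assume s: "Re s \<ge> \<sigma>"
    then have s1: "Re s > 1" using \<sigma> by simp
    let ?D = "\<lambda>pk. twist (\<lambda>_. t) pk * b (fst pk ^ snd pk) * exp (- (of_real (log_power pk) * s))
        - twist w pk * b (fst pk ^ snd pk) * exp (- (of_real (log_power pk) * s))"
    have Dle: "norm (?D pk) \<le> norm (twist (\<lambda>_. t) pk - twist w pk) * M pk" if "pk \<in> prime_powers" for pk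
    proof -
      have "?D pk = (twist (\<lambda>_. t) pk - twist w pk) * (b (fst pk ^ snd pk) * exp (- (of_real (log_power pk) * s)))"
        by (simp add: algebra_simps)
      then have "norm (?D pk) = norm (twist (\<lambda>_. t) pk - twist w pk) *
          (norm (b (fst pk ^ snd pk)) * exp (- (log_power pk * Re s)))"
        by (simp only: norm_mult[of "twist (\<lambda>_. t) pk - twist w pk"] norm_gds_term)
      also have "\<dots> \<le> norm (twist (\<lambda>_. t) pk - twist w pk) * M pk"
        unfolding M_def using log_power_nonneg[OF that] s by (intro mult_left_mono) (auto intro: mult_left_mono)
      finally show ?thesis .
    qed
    define g where "g pk = (if pk \<in> F then real N * \<delta> * M pk else 2 * M pk)" for pk
    have gF: "(g has_sum (real N * \<delta> * sum M F)) F"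
      using F(1) by (intro has_sum_finiteI) (auto simp: g_def sum_distrib_left)
    have gT: "(g has_sum (2 * infsum M (prime_powers - F))) (prime_powers - F)"
      using has_sum_cmult_right[OF has_sum_infsum[OF sumT], of 2]
      by (rule has_sum_cong[THEN iffD1, rotated]) (auto simp: g_def)
    have g: "(g has_sum (real N * \<delta> * sum M F + 2 * infsum M (prime_powers - F))) prime_powers"
      using has_sum_Un_disjoint[OF gF gT] F(2) by (simp add: Un_absorb1)
    have "(?D has_sum (twisted_log b (\<lambda>_. t) s - twisted_log b w s)) prime_powers"
      unfolding twisted_log_def gds_def
      by (intro has_sum_diff_complex has_sum_infsum gds_conv_summable twisted_log_conv conv s1)
    then have "norm (twisted_log b (\<lambda>_. t) s - twisted_log b w s)
        \<le> real N * \<delta> * sum M F + 2 * infsum M (prime_powers - F)"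
    proof (rule norm_infsum_le[OF _ g])
      fix pk assume pk: "pk \<in> prime_powers"
      have "norm (twist (\<lambda>_. t) pk - twist w pk) \<le> (if pk \<in> F then real N * \<delta> else 2)"
        using tw norm_triangle_ineq4[of "twist (\<lambda>_. t) pk" "twist w pk"] by auto
      then have "norm (twist (\<lambda>_. t) pk - twist w pk) * M pk \<le> g pk"
        using mult_right_mono[OF _ M0[of pk]] by (fastforce simp: g_def)
      with Dle[OF pk] show "norm (?D pk) \<le> g pk" by linarith
    qed
    also have "\<dots> \<le> \<epsilon> / 2 + 2 * (\<epsilon> / 4)"
    proof (intro add_mono mult_left_mono tail)
      have "real N * \<delta> * sum M F \<le> (real N + 1) * \<delta> * (sum M F + 1)"
        using \<delta> SF by (intro mult_mono) auto
      also have "\<dots> = \<epsilon> / 2"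
      proof -
        have *: "A * (\<epsilon> / (2 * A * B)) * B = \<epsilon> / 2" if "A > 0" "B > 0" for A B :: real
          using that by (simp add: field_simps)
        show ?thesis unfolding \<delta>_def by (rule *) (use SF in auto)
      qed
      finally show "real N * \<delta> * sum M F \<le> \<epsilon> / 2" .
    qed auto
    finally show "norm (twisted_log b (\<lambda>_. 0) (s + \<i> * of_real t) - twisted_log b w s) \<le> \<epsilon>"
      by (simp add: twisted_log_translate)
  qed
qed

text \<open>Hurwitz's theorem transfers the absence of zeros off the line from \<open>log F\<close> to all its twists.\<close>

lemma twisted_log_zeros_on_line:
  assumes conv: "log_conv b" and p: "prime p" "b p \<noteq> 0"
    and S: "open S" "connected S" "S \<subseteq> {s. Re s > \<sigma>}" and \<sigma>: "\<sigma> > 1"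
    and inv: "\<And>s t. s \<in> S \<Longrightarrow> s + \<i> * of_real t \<in> S"
    and nz: "\<And>s. s \<in> S \<Longrightarrow> twisted_log b (\<lambda>_. 0) s \<noteq> c" and z: "z \<in> S"
  shows "twisted_log b w z \<noteq> c"
proof -
  have "\<exists>t. \<forall>s. Re s \<ge> \<sigma> \<longrightarrow> norm (twisted_log b (\<lambda>_. 0) (s + \<i> * of_real t) - twisted_log b w s) \<le> 1 / Suc n" for n
    by (rule exists_translate_near_twisted_log[OF conv \<sigma>]) simp
  then obtain T where T: "\<And>n s. Re s \<ge> \<sigma> \<Longrightarrow>
      norm (twisted_log b (\<lambda>_. 0) (s + \<i> * of_real (T n)) - twisted_log b w s) \<le> 1 / Suc n"
    by metis
  have S1: "S \<subseteq> {s. Re s > 1}" using S(3) \<sigma> by auto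
  have "twisted_log b w z - c \<noteq> 0"
  proof (rule Hurwitz_no_zeros[of S "\<lambda>n s. twisted_log b (\<lambda>_. 0) (s + \<i> * of_real (T n)) - c" "\<lambda>s. twisted_log b w s - c"])
    show "(\<lambda>s. twisted_log b (\<lambda>_. 0) (s + \<i> * of_real (T n)) - c) holomorphic_on S" for n
      unfolding twisted_log_translate
      by (intro holomorphic_intros holomorphic_on_subset[OF twisted_log_holomorphic[OF conv] S1])
    show "(\<lambda>s. twisted_log b w s - c) holomorphic_on S"
      by (intro holomorphic_intros holomorphic_on_subset[OF twisted_log_holomorphic[OF conv] S1])
    show "\<not> (\<lambda>s. twisted_log b w s - c) constant_on S"
    proof
      assume "(\<lambda>s. twisted_log b w s - c) constant_on S"
      then have "twisted_log b w constant_on S" unfolding constant_on_def by (metis diff_add_cancel)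
      then show False using twisted_log_not_constant[OF conv p S(1) _ S1] z by auto
    qed
    show "twisted_log b (\<lambda>_. 0) (s + \<i> * of_real (T n)) - c \<noteq> 0" if "s \<in> S" for n s
      using nz[OF inv[OF that]] by simp
    fix K assume K: "compact K" "K \<subseteq> S"
    show "uniform_limit K (\<lambda>n s. twisted_log b (\<lambda>_. 0) (s + \<i> * of_real (T n)) - c)
            (\<lambda>s. twisted_log b w s - c) sequentially"
    proof (rule uniform_limitI)
      fix e :: real assume "e > 0"
      then obtain n0 where n0: "1 / Suc n0 < e" using nat_approx_posE by blast
      have "\<forall>s\<in>K. dist (twisted_log b (\<lambda>_. 0) (s + \<i> * of_real (T n)) - c) (twisted_log b w s - c) < e" if "n \<ge> n0" for n
      proof
        fix s assume "s \<in> K"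
        then have "Re s \<ge> \<sigma>" using K S by auto
        then have "norm (twisted_log b (\<lambda>_. 0) (s + \<i> * of_real (T n)) - twisted_log b w s) \<le> 1 / Suc n" by (rule T)
        also have "\<dots> \<le> 1 / Suc n0" using that by (intro divide_left_mono) auto
        finally show "dist (twisted_log b (\<lambda>_. 0) (s + \<i> * of_real (T n)) - c) (twisted_log b w s - c) < e"
          using n0 by (simp add: dist_norm)
      qed
      then show "\<forall>\<^sub>F n in sequentially. \<forall>s\<in>K.
          dist (twisted_log b (\<lambda>_. 0) (s + \<i> * of_real (T n)) - c) (twisted_log b w s - c) < e"
        unfolding eventually_sequentially by blast
    qed
  qed (use S z in auto)
  then show ?thesis by simp
qed

text \<open>The line cuts a strip around it into two open half-strips on which
  \<open>log F - c\<close> has no zeros. Each is connected and invariant under vertical translation,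
  so the preceding lemma carries this over to every twist.\<close>

lemma isolated_zero_line_twisted:
  assumes conv: "log_conv b" and p: "prime p" "b p \<noteq> 0" and \<beta>: "\<beta> > 1"
    and iso: "isolated_zero_line (\<lambda>s. log_dirichlet_series b s - c) \<beta>"
  shows "\<exists>\<delta>>0. \<beta> - \<delta> > 1 \<and> (\<forall>w s. \<bar>Re s - \<beta>\<bar> < \<delta> \<longrightarrow> twisted_log b w s = c \<longrightarrow> Re s = \<beta>)"
proof -
  obtain d where d: "d > 0" "\<And>s. 0 < \<bar>Re s - \<beta>\<bar> \<Longrightarrow> \<bar>Re s - \<beta>\<bar> < d \<Longrightarrow> twisted_log b (\<lambda>_. 0) s \<noteq> c"
    using iso unfolding isolated_zero_line_def log_dirichlet_series_eq by auto
  \<comment> \<open>Half the distance from \<open>\<beta>\<close> to \<open>1\<close> keeps the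
    strip inside \<open>Re s > \<beta> - \<delta> > 1\<close>, where the approximation is
    uniform.\<close>
  define \<delta> where "\<delta> = min d ((\<beta> - 1) / 2)"
  have \<delta>: "\<delta> > 0" "\<delta> \<le> d" "\<beta> - \<delta> > 1"
    using d(1) \<beta> by (auto simp: \<delta>_def min_def field_simps)
  have strip: "{s. u < Re s \<and> Re s < v} = {s. Re s > u} \<inter> {s. Re s < v}" for u v by auto
  have open_strip: "open {s. u < Re s \<and> Re s < v}" for u v
    unfolding strip by (intro open_Int open_halfspace_Re_gt open_halfspace_Re_lt)
  have conn_strip: "connected {s. u < Re s \<and> Re s < v}" for u v
    unfolding strip by (intro convex_connected convex_Int convex_halfspace_Re_gt convex_halfspace_Re_lt)
  have "twisted_log b w s \<noteq> c" if "\<bar>Re s - \<beta>\<bar> < \<delta>" "Re s \<noteq> \<beta>" for w s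
  proof (cases "Re s < \<beta>")
    case True
    show ?thesis
      by (rule twisted_log_zeros_on_line[OF conv p open_strip conn_strip _ \<delta>(3), of "\<beta> - \<delta>" \<beta>])
        (use d(2) \<delta> that True in auto)
  next
    case False
    show ?thesis
      by (rule twisted_log_zeros_on_line[OF conv p open_strip conn_strip _ \<beta>, of \<beta> "\<beta> + \<delta>"])
        (use d(2) \<delta> that False in auto)
  qed
  then show ?thesis using \<delta> by blast
qed

section \<open>Coefficients at primes\<close>

lemma abs_summable_Times_mult:
  fixes f :: "'i \<Rightarrow> complex" and g :: "'j \<Rightarrow> complex"
  assumes f: "(\<lambda>i. norm (f i)) summable_on A" and g: "(\<lambda>j. norm (g j)) summable_on B"
  shows "(\<lambda>(i, j). norm (f i * g j)) summable_on A \<times> B"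
proof -
  have *: "(\<lambda>p. norm (case p of (i, j) \<Rightarrow> f i * g j)) summable_on A \<times> B"
    unfolding Infinite_Sum.abs_summable_on_Sigma_iff
  proof (intro conjI ballI)
    fix i assume "i \<in> A"
    show "(\<lambda>j. norm (case (i, j) of (i, j) \<Rightarrow> f i * g j)) summable_on B"
      using summable_on_cmult_right[OF g, of "norm (f i)"] by (simp add: norm_mult)
  next
    have "infsum (\<lambda>j. norm (case (i, j) of (i, j) \<Rightarrow> f i * g j)) B = norm (f i) * infsum (\<lambda>j. norm (g j)) B" for i
      by (simp add: norm_mult infsum_cmult_right')
    moreover have "(\<lambda>i. norm (norm (f i) * infsum (\<lambda>j. norm (g j)) B)) summable_on A"
      using summable_on_cmult_left[OF f, of "infsum (\<lambda>j. norm (g j)) B"] by (simp add: infsum_nonneg)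
    ultimately show "(\<lambda>i. norm (infsum (\<lambda>j. norm (case (i, j) of (i, j) \<Rightarrow> f i * g j)) B)) summable_on A"
      by (simp only:)
  qed
  then show ?thesis by (simp add: case_prod_beta')
qed

lemma has_sum_Times_mult:
  fixes f :: "'i \<Rightarrow> complex" and g :: "'j \<Rightarrow> complex"
  assumes f: "(\<lambda>i. norm (f i)) summable_on A" and g: "(\<lambda>j. norm (g j)) summable_on B"
  shows "((\<lambda>(i, j). f i * g j) has_sum (infsum f A * infsum g B)) (A \<times> B)"
proof -
  have "(\<lambda>p. norm (case p of (i, j) \<Rightarrow> f i * g j)) summable_on A \<times> B"
    using abs_summable_Times_mult[OF assms] by (simp add: case_prod_beta')
  then have sum: "(\<lambda>(i, j). f i * g j) summable_on A \<times> B" by (rule abs_summable_summable)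
  have "infsum (\<lambda>(i, j). f i * g j) (A \<times> B) = (\<Sum>\<^sub>\<infinity>i\<in>A. \<Sum>\<^sub>\<infinity>j\<in>B. f i * g j)"
    using infsum_Sigma'_banach[OF sum] by simp
  also have "\<dots> = infsum f A * infsum g B"
    by (simp add: infsum_cmult_right' infsum_cmult_left')
  finally show "((\<lambda>(i, j). f i * g j) has_sum (infsum f A * infsum g B)) (A \<times> B)"
    using sum by (metis has_sum_infsum)
qed

text \<open>The product is indexed by pairs, with exponents added and equal exponents left unmerged.
  Level sums collect them later, in place of a Dirichlet convolution.\<close>

lemma gds_conv_Times:
  assumes c: "gds_conv I c l" and d: "gds_conv J d m"
  shows "gds_conv (I \<times> J) (\<lambda>(i, j). c i * d j) (\<lambda>(i, j). l i + m j)"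
  unfolding gds_conv_def
proof (intro conjI allI impI)
  show "\<forall>i\<in>I \<times> J. 0 \<le> (case i of (i, j) \<Rightarrow> l i + m j)" using c d by (auto simp: gds_conv_def)
  fix \<sigma> :: real assume "\<sigma> > 1"
  have e: "exp (- ((u + v) * \<sigma>)) = exp (- (u * \<sigma>)) * exp (- (v * \<sigma>))" for u v
    by (simp add: distrib_right flip: exp_add)
  from \<open>\<sigma> > 1\<close> have "(\<lambda>(i, j). norm (c i * exp (- (of_real (l i) * of_real \<sigma>)) * (d j * exp (- (of_real (m j) * of_real \<sigma>))))) summable_on I \<times> J"
    by (intro abs_summable_Times_mult gds_conv_abs_summable c d) auto
  then show "(\<lambda>i. norm (case i of (i, j) \<Rightarrow> c i * d j) * exp (- ((case i of (i, j) \<Rightarrow> l i + m j) * \<sigma>))) summable_on I \<times> J"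
    by (rule summable_on_cong[THEN iffD1, rotated]) (auto simp: norm_mult e)
qed

lemma gds_Times:
  assumes c: "gds_conv I c l" and d: "gds_conv J d m" and s: "Re s > 1"
  shows "gds (I \<times> J) (\<lambda>(i, j). c i * d j) (\<lambda>(i, j). l i + m j) s = gds I c l s * gds J d m s"
proof -
  have t: "(case ij of (i, j) \<Rightarrow> c i * d j) * exp (- (of_real (case ij of (i, j) \<Rightarrow> l i + m j) * s))
      = (case ij of (i, j) \<Rightarrow> (c i * exp (- (of_real (l i) * s))) * (d j * exp (- (of_real (m j) * s))))" for ij s
    by (cases ij) (simp add: algebra_simps exp_diff exp_minus divide_inverse)
  show ?thesis
    unfolding gds_def t by (intro infsumI has_sum_Times_mult gds_conv_abs_summable c d s)
qed

lemma gds_conv_Plus: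
  assumes c: "gds_conv I c l" and d: "gds_conv J d m"
  shows "gds_conv (I <+> J) (case_sum c d) (case_sum l m)"
  using c d unfolding gds_conv_def Plus_def
  by (auto intro!: summable_on_Un_disjoint simp: summable_on_reindex o_def)

lemma gds_Plus:
  assumes c: "gds_conv I c l" and d: "gds_conv J d m" and s: "Re s > 1"
  shows "gds (I <+> J) (case_sum c d) (case_sum l m) s = gds I c l s + gds J d m s"
  unfolding gds_def Plus_def
  using gds_conv_summable[OF c s] gds_conv_summable[OF d s]
  by (subst infsum_Un_disjoint) (auto simp: summable_on_reindex infsum_reindex o_def)

section \<open>The identity \<open>F' = (log F)' F\<close>\<close>

lemma cond_I_imp_conv:
  assumes "cond_I a"
  shows "gds_conv {1..} a (\<lambda>n. ln (real n))"
  unfolding gds_conv_def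
proof (intro conjI ballI allI impI)
  fix \<sigma> :: real assume "\<sigma> > 1"
  then have "(\<lambda>n. norm (a n * of_nat n powr (- of_real \<sigma>))) summable_on {1..}"
    using assms by (auto simp: cond_I_def)
  then show "(\<lambda>n. norm (a n) * exp (- (ln (real n) * \<sigma>))) summable_on {1..}"
    by (rule summable_on_cong[THEN iffD1, rotated])
       (auto simp: norm_mult powr_def Ln_of_nat mult.commute)
qed auto

lemma dirichlet_series_eq_gds: "dirichlet_series a = gds {1..} a (\<lambda>n. ln (real n))"
  unfolding dirichlet_series_def gds_def
  by (intro ext infsum_cong) (auto simp: powr_def Ln_of_nat mult.commute)

text \<open>Both sides are derivatives at \<open>s\<close> of one function, since
  \<open>exp (log F) = F\<close> on the open half-plane.\<close>

lemma log_derivative_eq: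
  assumes I: "cond_I a" and II: "cond_II a b" and s: "Re s > 1"
  shows "gds {1..} (\<lambda>n. - of_real (ln (real n)) * a n) (\<lambda>n. ln (real n)) s =
    gds prime_powers (\<lambda>pk. - of_real (log_power pk) * b (fst pk ^ snd pk)) log_power s *
    gds {1..} a (\<lambda>n. ln (real n)) s" (is "gds _ ?a' _ s = gds _ ?b' _ s * ?F s")
proof (rule DERIV_unique)
  let ?L = "gds prime_powers (\<lambda>pk. b (fst pk ^ snd pk)) log_power"
  have L_eq: "?L = log_dirichlet_series b"
    unfolding log_dirichlet_series_eq twisted_log_def by (simp add: twist_def)
  note ca = cond_I_imp_conv[OF I]
  note cb = cond_II_imp_log_conv[OF II]
  have FL: "exp (?L s) = ?F s" if "Re s > 1" for s
    using II that unfolding cond_II_def L_eq dirichlet_series_eq_gds by blast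
  show "(?F has_field_derivative gds {1..} ?a' (\<lambda>n. ln (real n)) s) (at s)"
    by (rule gds_has_field_derivative[OF ca s])
  have "((\<lambda>s. exp (?L s)) has_field_derivative gds prime_powers ?b' log_power s * ?F s) (at s)"
    unfolding FL[OF s, symmetric]
    using DERIV_chain2[OF DERIV_exp gds_has_field_derivative[OF cb s]] by (simp add: mult.commute)
  then show "(?F has_field_derivative gds prime_powers ?b' log_power s * ?F s) (at s)"
    by (rule has_field_derivative_transform_within_open[of _ _ _ "{s. Re s > 1}"])
       (use s FL open_halfspace_Re_gt in auto)
qed

lemma ln_le_imp_le_nat_ceiling:
  assumes "ln (real n) \<le> x" "n \<ge> 1"
  shows "n \<le> nat \<lceil>exp x\<rceil>"
proof -
  have "real n = exp (ln (real n))" using assms by simp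
  also have "\<dots> \<le> exp x" unfolding exp_le_cancel_iff by (rule assms)
  finally have "real n \<le> exp x" .
  then show ?thesis by linarith
qed

lemma finite_log_power_plus_ln_le:
  "finite {pn \<in> prime_powers \<times> {1..}. log_power (fst pn) + ln (real (snd pn)) \<le> x}"
proof (rule finite_subset)
  show "{pn \<in> prime_powers \<times> {1..}. log_power (fst pn) + ln (real (snd pn)) \<le> x}
      \<subseteq> {pk \<in> prime_powers. log_power pk \<le> x} \<times> {..nat \<lceil>exp x\<rceil>}"
  proof
    fix pn assume pn: "pn \<in> {pn \<in> prime_powers \<times> {1..}. log_power (fst pn) + ln (real (snd pn)) \<le> x}"
    obtain pk n where eq: "pn = (pk, n)" by (cases pn)
    have pkn: "pk \<in> prime_powers" "n \<ge> 1" "log_power pk + ln (real n) \<le> x" using pn eq by auto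
    then have "log_power pk \<ge> 0" "ln (real n) \<ge> 0" by (auto simp: log_power_nonneg)
    then have "log_power pk \<le> x" "ln (real n) \<le> x" using pkn(3) by linarith+
    then show "pn \<in> {pk \<in> prime_powers. log_power pk \<le> x} \<times> {..nat \<lceil>exp x\<rceil>}"
      using ln_le_imp_le_nat_ceiling[of n x] pkn eq by simp
  qed
qed (use finite_log_power_le in simp)

text \<open>A prime power exceeds \<open>1\<close>, so if its product with \<open>n\<close> is
  prime, it must be that prime itself.\<close>

lemma log_power_plus_ln_eq_ln_prime_iff:
  assumes pk: "pk \<in> prime_powers" and n: "n \<ge> 1" and q: "prime q"
  shows "log_power pk + ln (real n) = ln (real q) \<longleftrightarrow> pk = (q, 1) \<and> n = 1"
proof
  assume eq: "log_power pk + ln (real n) = ln (real q)"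
  define m where "m = fst pk ^ snd pk"
  have p: "prime (fst pk)" "snd pk \<ge> 1" using pk by (auto simp: prime_powers_def)
  have m: "m > 0" unfolding m_def using prime_gt_0_nat[OF p(1)] by simp
  have "ln (real m) + ln (real n) = ln (real q)" using eq log_power_eq_ln[OF pk] by (simp add: m_def)
  then have "ln (real (m * n)) = ln (real q)" using m n by (simp add: ln_mult)
  moreover have "real (m * n) > 0" "real q > 0" using m n prime_gt_0_nat[OF q] by simp_all
  ultimately have "real (m * n) = real q" using ln_inj_iff by blast
  then have mn: "m * n = q" by (simp only: of_nat_eq_iff)
  have "1 < m" unfolding m_def
    by (rule one_less_power[OF prime_gt_1_nat[OF p(1)]]) (use p(2) in simp)
  then have "m \<noteq> 1" by simp
  moreover have "m dvd q" using mn by (rule dvdI[OF sym])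
  ultimately have "m = q" using q unfolding prime_nat_iff by blast
  then have n1: "n = 1" using mn m by simp
  then have "log_power pk = ln (real q)" using eq by simp
  then show "pk = (q, 1) \<and> n = 1" using log_power_eq_ln_prime_iff[OF pk q] n1 by simp
qed (simp add: log_power_def)

text \<open>Comparison of coefficients at a prime in \<open>F' = (log F)' F\<close>.\<close>

lemma coeff_prime_eq:
  assumes I: "cond_I a" and II: "cond_II a b" and q: "prime q"
  shows "a q = b q * a 1"
proof -
  let ?a' = "\<lambda>n. - of_real (ln (real n)) * a n"
  let ?b' = "\<lambda>pk. - of_real (log_power pk) * b (fst pk ^ snd pk)"
  note ca = cond_I_imp_conv[OF I]
  note ca' = gds_conv_deriv[OF ca]
  note cb' = gds_conv_deriv[OF cond_II_imp_log_conv[OF II]]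
  have cm: "gds_conv {1..} (\<lambda>n. - 1 * ?a' n) (\<lambda>n. ln (real n))"
    by (rule gds_conv_bounded_mult[OF ca', of _ 1]) simp
  \<comment> \<open>The left summand carries \<open>- F'\<close>, the right one the product
    \<open>(log F)' F\<close>. The combined series vanishes identically, hence so do all its level
    sums.\<close>
  let ?I = "{1..} <+> (prime_powers \<times> {1..})"
  let ?c = "case_sum (\<lambda>n. - 1 * ?a' n) (\<lambda>(pk, n). ?b' pk * a n)"
  let ?l = "case_sum (\<lambda>n. ln (real n)) (\<lambda>(pk, n). log_power pk + ln (real n))"
  note cp = gds_conv_Times[OF cb' ca]
  have conv: "gds_conv ?I ?c ?l" by (rule gds_conv_Plus[OF cm cp])
  have zero: "gds ?I ?c ?l s = 0" if s: "Re s > 1" for s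
  proof -
    have "gds {1..} (\<lambda>n. - 1 * ?a' n) (\<lambda>n. ln (real n)) s = - gds {1..} ?a' (\<lambda>n. ln (real n)) s"
      unfolding gds_def by (simp add: infsum_uminus[symmetric] del: infsum_uminus)
    then show ?thesis
      using gds_Plus[OF cm cp s] gds_Times[OF cb' ca s] log_derivative_eq[OF I II s] by simp
  qed
  have fin: "finite {i \<in> ?I. ?l i \<le> x}" for x
  proof -
    have "{i \<in> ?I. ?l i \<le> x} = {n \<in> {1..}. ln (real n) \<le> x} <+>
        {pn \<in> prime_powers \<times> {1..}. log_power (fst pn) + ln (real (snd pn)) \<le> x}"
      by auto
    moreover have "finite {n \<in> {1..}. ln (real n) \<le> x}"
      by (rule finite_subset[of _ "{..nat \<lceil>exp x\<rceil>}"]) (auto intro: ln_le_imp_le_nat_ceiling)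
    ultimately show ?thesis using finite_log_power_plus_ln_le[of x] by simp
  qed
  have "(\<Sum>i | i \<in> ?I \<and> ?l i = ln (real q). ?c i) = 0"
    by (rule gds_eq_0_imp_level_sum_eq_0[OF conv fin zero])
  \<comment> \<open>The two indices contribute \<open>ln q * a q\<close> and
    \<open>- ln q * b q * a 1\<close>.\<close>
  also have "{i. i \<in> ?I \<and> ?l i = ln (real q)} = {Inl q, Inr ((q, 1), 1)}"
  proof -
    have n: "n \<ge> 1 \<and> ln (real n) = ln (real q) \<longleftrightarrow> n = q" for n
      using prime_gt_0_nat[OF q] by (cases "n = 0") auto
    have "(q, 1) \<in> prime_powers" using q by (simp add: prime_powers_def)
    then have pn: "pk \<in> prime_powers \<and> n \<ge> 1 \<and> log_power pk + ln (real n) = ln (real q) \<longleftrightarrow> pk = (q, 1) \<and> n = 1" for pk n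
      using log_power_plus_ln_eq_ln_prime_iff[OF _ _ q] by blast
    have "i \<in> ?I \<and> ?l i = ln (real q) \<longleftrightarrow> i = Inl q \<or> i = Inr ((q, 1), 1)" for i
    proof (cases i)
      case (Inl m)
      then show ?thesis using n[of m] by auto
    next
      case (Inr pn)
      then show ?thesis using pn[of "fst pn" "snd pn"] by (cases pn) auto
    qed
    then show ?thesis by blast
  qed
  finally have "of_real (ln (real q)) * a q = of_real (ln (real q)) * (b q * a 1)"
    by (simp add: log_power_def)
  then show ?thesis using prime_gt_1_nat[OF q] by simp
qed

section \<open>Euler factors at primes with large coefficients\<close>

text \<open>Otherwise \<open>a p = b p * a 1\<close> would bound the terms beyond \<open>N\<close>
  by a multiple of \<open>p powr (-1 - 2 * \<epsilon>)\<close>. The sum over primes would stay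
  bounded, whereas the asymptotic formula makes it grow like
  \<open>\<kappa> * ln (ln x)\<close>.\<close>

lemma exists_large_prime_coeff:
  fixes a :: "nat \<Rightarrow> complex"
  assumes \<kappa>: "\<kappa> > 0"
    and asym: "(\<lambda>x::real. (\<Sum>p | prime p \<and> real p \<le> x. (norm (a p))\<^sup>2 / real p) - \<kappa> * ln (ln x))
           \<in> o[at_top](\<lambda>x. ln (ln x))"
    and I: "cond_I a" and II: "cond_II a b" and \<epsilon>: "\<epsilon> > 0"
  shows "\<exists>p>N. prime p \<and> norm (b p) \<ge> real p powr (- \<epsilon>)"
proof (rule ccontr)
  assume none: "\<not> (\<exists>p>N. prime p \<and> norm (b p) \<ge> real p powr (- \<epsilon>))"
  have small: "norm (b p) < real p powr (- \<epsilon>)" if "prime p" "p > N" for p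
  proof -
    have "\<not> norm (b p) \<ge> real p powr (- \<epsilon>)" using none that by blast
    then show ?thesis by (simp only: not_le)
  qed
  define g where "g n = (norm (a n))\<^sup>2 / real n" for n
  \<comment> \<open>The second summand takes care of the primes up to \<open>N\<close>, where
    \<open>b p\<close> may be large.\<close>
  define h where "h n = (norm (a 1))\<^sup>2 * real n powr (-1 - 2 * \<epsilon>) + (if n \<le> N then g n else 0)" for n
  have h0: "h n \<ge> 0" for n by (auto simp: h_def g_def)
  have sumh: "summable h" unfolding h_def
  proof (intro summable_add summable_mult)
    show "summable (\<lambda>n. real n powr (-1 - 2 * \<epsilon>))" using \<epsilon> by (simp add: summable_real_powr_iff)
    show "summable (\<lambda>n. if n \<le> N then g n else 0)"
      by (rule summable_finite[of "{..N}"]) auto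
  qed
  have gh: "g p \<le> h p" if p: "prime p" for p
  proof (cases "p \<le> N")
    case False
    have "(norm (b p))\<^sup>2 \<le> (real p powr (- \<epsilon>))\<^sup>2" using small[OF p] False by (intro power_mono) auto
    also have "\<dots> = real p powr (- 2 * \<epsilon>)" by (simp add: power2_eq_square flip: powr_add)
    finally have "(norm (a 1))\<^sup>2 * (norm (b p))\<^sup>2 / real p \<le> (norm (a 1))\<^sup>2 * real p powr (- 2 * \<epsilon>) / real p"
      by (intro divide_right_mono mult_left_mono) auto
    also have "\<dots> = (norm (a 1))\<^sup>2 * real p powr (-1 - 2 * \<epsilon>)"
      using prime_gt_0_nat[OF p] by (simp add: powr_diff powr_minus field_simps)
    finally show ?thesis using False coeff_prime_eq[OF I II p] by (simp add: g_def h_def norm_mult power_mult_distrib mult.commute)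
  qed (simp add: h_def)
  have bounded: "(\<Sum>p | prime p \<and> real p \<le> x. (norm (a p))\<^sup>2 / real p) \<le> suminf h" for x :: real
  proof -
    have fin: "finite {p. prime p \<and> real p \<le> x}"
    proof (rule finite_subset)
      show "{p. prime p \<and> real p \<le> x} \<subseteq> {..nat \<lceil>x\<rceil>}"
      proof
        fix p assume "p \<in> {p. prime p \<and> real p \<le> x}"
        then have "real p \<le> x" by simp
        then show "p \<in> {..nat \<lceil>x\<rceil>}" unfolding atMost_iff by linarith
      qed
    qed simp
    have "(\<Sum>p | prime p \<and> real p \<le> x. (norm (a p))\<^sup>2 / real p) \<le> (\<Sum>p | prime p \<and> real p \<le> x. h p)"
      using gh by (intro sum_mono) (auto simp: g_def)
    also have "\<dots> \<le> suminf h" by (rule sum_le_suminf[OF sumh fin]) (use h0 in auto)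
    finally show ?thesis .
  qed
  have "\<forall>\<^sub>F x in at_top. norm ((\<Sum>p | prime p \<and> real p \<le> x. (norm (a p))\<^sup>2 / real p) - \<kappa> * ln (ln x))
      \<le> \<kappa> / 2 * norm (ln (ln x))"
    using landau_o.smallD[OF asym, of "\<kappa> / 2"] \<kappa> by simp
  \<comment> \<open>The threshold \<open>0\<close> removes the absolute value around
    \<open>ln (ln x)\<close>; the other makes \<open>\<kappa> / 2 * ln (ln x)\<close> exceed the
    bound \<open>suminf h\<close>.\<close>
  moreover have "\<forall>\<^sub>F x::real in at_top. ln (ln x) > max 0 (2 * suminf h / \<kappa>)"
  proof -
    have "filterlim (\<lambda>x::real. ln (ln x)) at_top at_top"
      by (rule filterlim_compose[OF ln_at_top ln_at_top])
    then show ?thesis by (simp only: filterlim_at_top_dense)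
  qed
  ultimately have "\<forall>\<^sub>F x::real in at_top. False"
  proof eventually_elim
    case (elim x)
    have "\<kappa> / 2 * ln (ln x) \<le> (\<Sum>p | prime p \<and> real p \<le> x. (norm (a p))\<^sup>2 / real p)"
      using elim by (simp add: abs_if split: if_splits)
    also have "\<dots> \<le> suminf h" by (rule bounded)
    also have "\<dots> < \<kappa> / 2 * ln (ln x)" using elim \<kappa> by (simp add: field_simps)
    finally show ?case by simp
  qed
  then show False by simp
qed

section \<open>Tails of Euler factors\<close>

definition geom_const :: real where
  "geom_const = (\<Sum>\<^sub>\<infinity>k\<in>{2..}. (real k)\<^sup>2 * (3/4) ^ (k - 2))"

lemma geom_summable: "(\<lambda>k. (real k)\<^sup>2 * (3/4) ^ (k - 2)) summable_on {2..}"
proof (rule summable_on_comparison_test)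
  \<comment> \<open>Write \<open>3/4 = 6/7 * 7/8\<close>: the factor \<open>(6/7) ^ k\<close>
    absorbs \<open>k^2\<close> and \<open>(7/8) ^ k\<close> is left. This \<open>e\<close> gives
    \<open>exp (- (k * e)) ^ 2 = (6/7) ^ k\<close>; the later constant \<open>16/9\<close> accounts
    for the exponent \<open>k - 2\<close>.\<close>
  define e :: real where "e = ln (7/6) / 2"
  have e: "e > 0" by (simp add: e_def)
  have "summable (\<lambda>k. norm ((7/8 :: real) ^ k))" by simp
  then have "(\<lambda>k. (7/8 :: real) ^ k) summable_on UNIV" by (rule norm_summable_imp_summable_on)
  then have "(\<lambda>k. (7/8 :: real) ^ k) summable_on {2..}" by (rule summable_on_subset_banach) simp
  then show "(\<lambda>k. 16/9 * (1/e)\<^sup>2 * (7/8 :: real) ^ k) summable_on {2..}" by (rule summable_on_cmult_right)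
  fix k :: nat assume k: "k \<in> {2..}"
  have "exp (- (real k * e)) ^ 2 = exp (- ln (7/6)) ^ k"
    by (simp add: e_def algebra_simps flip: exp_of_nat_mult)
  also have "exp (- ln (7/6)) = (6/7 :: real)" by (simp add: exp_minus)
  finally have exp2: "exp (- (real k * e)) ^ 2 = (6/7) ^ k" .
  have "(real k * exp (- (real k * e)))\<^sup>2 \<le> (1/e)\<^sup>2"
    using e by (intro power_mono mult_exp_neg_le) auto
  then have "(real k)\<^sup>2 * (6/7) ^ k \<le> (1/e)\<^sup>2" unfolding power_mult_distrib exp2 .
  then have "16/9 * ((real k)\<^sup>2 * (6/7) ^ k) * (7/8) ^ k \<le> 16/9 * (1/e)\<^sup>2 * (7/8) ^ k"
    by (intro mult_right_mono mult_left_mono) auto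
  also have "16/9 * ((real k)\<^sup>2 * (6/7) ^ k) * (7/8) ^ k = (real k)\<^sup>2 * (16/9 * (3/4) ^ k)"
    by (simp flip: power_mult_distrib)
  also have "16/9 * (3/4 :: real) ^ k = (3/4) ^ (k - 2)"
  proof -
    obtain j where "k = 2 + j" using k le_Suc_ex[of 2 k] by auto
    then show ?thesis by (simp add: power2_eq_square power_add)
  qed
  finally show "(real k)\<^sup>2 * (3/4) ^ (k - 2) \<le> 16/9 * (1/e)\<^sup>2 * (7/8) ^ k" .
qed auto

lemma geom_const_nonneg: "geom_const \<ge> 0"
  unfolding geom_const_def by (intro infsum_nonneg) auto

text \<open>For \<open>x = p powr (- (Re s - \<theta>))\<close> the \<open>k\<close>-th term is at
  most \<open>B * k^2 * x ^ k\<close>. Since \<open>Re s - \<theta> > 1/2\<close> and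
  \<open>p \<ge> 2\<close>, \<open>x \<le> 1 / sqrt 2 < 3/4\<close>, so after extracting
  \<open>x^2\<close> the sum over \<open>k \<ge> 2\<close> is at most \<open>geom_const\<close>. The
  weight \<open>k^2\<close> leaves room for two derivatives.\<close>

lemma gds_powers_first_term:
  assumes conv: "gds_conv {1..} d (\<lambda>k. real k * ln (real p))" and p: "prime p"
    and d: "\<And>k. k \<ge> 2 \<Longrightarrow> norm (d k) \<le> B * (real k)\<^sup>2 * real p powr (real k * \<theta>)"
    and s: "Re s > 1" and \<theta>: "\<theta> < 1 / 2"
  shows "norm (gds {1..} d (\<lambda>k. real k * ln (real p)) s - d 1 * exp (- (of_real (ln (real p)) * s)))
     \<le> B * geom_const * real p powr (- 2 * (Re s - \<theta>))"
proof -
  have p2: "real p \<ge> 2" using prime_ge_2_nat[OF p] by simp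
  define x where "x = real p powr (- (Re s - \<theta>))"
  have "x \<le> real p powr (- (1/2))" unfolding x_def using p2 s \<theta> by (intro powr_mono) auto
  also have "\<dots> \<le> 2 powr (- (1/2))" using p2 by (intro powr_mono2') auto
  also have "\<dots> = 1 / sqrt 2" by (simp add: powr_minus powr_half_sqrt field_simps)
  also have "\<dots> \<le> 3 / 4"
  proof -
    have "4 / 3 \<le> sqrt 2" by (rule real_le_rsqrt) (simp add: power2_eq_square)
    then show ?thesis by (simp add: field_simps)
  qed
  finally have x: "0 \<le> x" "x \<le> 3 / 4" by (auto simp: x_def)
  have "0 \<le> norm (d 2)" by simp
  also have "\<dots> \<le> B * (real 2)\<^sup>2 * real p powr (real 2 * \<theta>)" by (rule d) simp
  finally have B: "B \<ge> 0" using p2 by (simp add: zero_le_mult_iff)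
  let ?t = "\<lambda>k. d k * exp (- (of_real (real k * ln (real p)) * s))"
  have sum2: "?t summable_on {2..}"
    by (rule gds_conv_summable[OF gds_conv_subset[OF conv] s]) auto
  have "{1..} = {1} \<union> {2::nat..}" by auto
  then have "gds {1..} d (\<lambda>k. real k * ln (real p)) s = infsum ?t ({1} \<union> {2..})" unfolding gds_def by simp
  also have "\<dots> = infsum ?t {1} + infsum ?t {2..}"
    by (rule infsum_Un_disjoint) (use sum2 in auto)
  finally have "gds {1..} d (\<lambda>k. real k * ln (real p)) s - d 1 * exp (- (of_real (ln (real p)) * s)) = infsum ?t {2..}"
    by simp
  also have "norm \<dots> \<le> B * x\<^sup>2 * geom_const"
  proof (rule norm_infsum_le)
    show "(?t has_sum infsum ?t {2..}) {2..}" using sum2 by (rule has_sum_infsum)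
    show "((\<lambda>k. B * x\<^sup>2 * ((real k)\<^sup>2 * (3/4) ^ (k - 2))) has_sum B * x\<^sup>2 * geom_const) {2..}"
      unfolding geom_const_def by (intro has_sum_cmult_right has_sum_infsum geom_summable)
    fix k :: nat assume k: "k \<in> {2..}"
    have "norm (?t k) = norm (d k) * exp (- (real k * ln (real p) * Re s))" by (rule norm_gds_term)
    also have "\<dots> \<le> B * (real k)\<^sup>2 * real p powr (real k * \<theta>) * exp (- (real k * ln (real p) * Re s))"
      using k by (intro mult_right_mono d) auto
    also have "\<dots> = B * (real k)\<^sup>2 * x ^ k"
      using p2 by (simp add: x_def powr_def algebra_simps flip: exp_add exp_of_nat_mult)
    also have "\<dots> = B * x\<^sup>2 * ((real k)\<^sup>2 * x ^ (k - 2))"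
      using k le_add_diff_inverse[of 2 k] power_add[of x 2 "k - 2"] by (simp add: mult_ac)
    also have "\<dots> \<le> B * x\<^sup>2 * ((real k)\<^sup>2 * (3/4) ^ (k - 2))"
      using x B by (intro mult_left_mono power_mono) auto
    finally show "norm (?t k) \<le> B * x\<^sup>2 * ((real k)\<^sup>2 * (3/4) ^ (k - 2))" .
  qed
  also have "x\<^sup>2 = real p powr (- 2 * (Re s - \<theta>))"
    by (simp add: x_def power2_eq_square flip: powr_add)
  finally show ?thesis by (simp add: mult_ac)
qed

text \<open>The coefficients here and in the second derivative keep the unsimplified shape that
  termwise differentiation produces.\<close>

definition log_factor' :: "(nat \<Rightarrow> complex) \<Rightarrow> nat \<Rightarrow> complex \<Rightarrow> complex" where
  "log_factor' b p = gds {1..} (\<lambda>k. - of_real (real k * ln (real p)) * b (p ^ k)) (\<lambda>k. real k * ln (real p))"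

definition log_factor'' :: "(nat \<Rightarrow> complex) \<Rightarrow> nat \<Rightarrow> complex \<Rightarrow> complex" where
  "log_factor'' b p = gds {1..} (\<lambda>k. - of_real (real k * ln (real p)) *
     (- of_real (real k * ln (real p)) * b (p ^ k))) (\<lambda>k. real k * ln (real p))"

lemma log_factor_has_derivative:
  assumes "log_conv b" "prime p" "Re s > 1"
  shows "(log_factor b p has_field_derivative log_factor' b p s) (at s)"
    "(log_factor' b p has_field_derivative log_factor'' b p s) (at s)"
  unfolding log_factor_def log_factor'_def log_factor''_def
  by (rule gds_has_field_derivative; (rule gds_conv_deriv)?; rule log_factor_conv[OF assms(1,2)] assms(3))+

text \<open>If \<open>b p\<close> is not too small, the Euler factor behaves like its first term \<open>b p * p powr -s\<close>.\<close>

lemma log_factor_logarithmic_derivative: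
  assumes conv: "log_conv b" and p: "prime p" and s: "Re s > 1" and \<theta>: "\<theta> < 1 / 2"
    and C: "\<And>k. k \<ge> 1 \<Longrightarrow> norm (b (p ^ k)) \<le> C * real p powr (real k * \<theta>)"
    and bp: "norm (b p) \<ge> real p powr (- \<epsilon>)"
    and r: "C * geom_const * real p powr (\<epsilon> - (Re s - 2 * \<theta>)) \<le> 1 / 2"
    and lr: "ln (real p) * (C * geom_const * real p powr (\<epsilon> - (Re s - 2 * \<theta>))) \<le> 1 / 8"
  shows "log_factor' b p s \<noteq> 0" "norm (log_factor'' b p s / log_factor' b p s + of_real (ln (real p))) \<le> 1 / 4"
proof -
  define l where "l = ln (real p)"
  have p2: "real p \<ge> 2" using prime_ge_2_nat[OF p] by simp
  have l: "l > 0" using p2 by (simp add: l_def)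
  \<comment> \<open>\<open>u\<close> is the first term of \<open>log_factor' b p s\<close>, and
    \<open>R\<close> bounds the remaining terms relative to it. The lower bound on
    \<open>norm (b p)\<close> is what puts \<open>\<epsilon>\<close> into the exponent of
    \<open>R\<close>.\<close>
  define u where "u = - of_real l * b p * exp (- (of_real l * s))"
  define R where "R = C * geom_const * real p powr (\<epsilon> - (Re s - 2 * \<theta>))"
  have conv0: "gds_conv {1..} (\<lambda>k. b (p ^ k)) (\<lambda>k. real k * ln (real p))" by (rule log_factor_conv[OF conv p])
  note conv1 = gds_conv_deriv[OF conv0]
  note conv2 = gds_conv_deriv[OF conv1]
  have up: "real p powr (- \<epsilon>) * real p powr (- Re s) * l \<le> norm u"
  proof -
    have "exp (- (l * Re s)) = real p powr (- Re s)" using p2 by (simp add: powr_def l_def mult.commute)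
    then have "norm u = norm (b p) * real p powr (- Re s) * l"
      using l by (simp add: u_def norm_mult)
    then show ?thesis using bp l by (auto intro!: mult_right_mono)
  qed
  have u: "u \<noteq> 0"
  proof -
    have "real p powr (- \<epsilon>) * real p powr (- Re s) * l > 0" using p2 l by simp
    with up show ?thesis by auto
  qed
  have "0 \<le> norm (b (p ^ 1))" by simp
  also have "\<dots> \<le> C * real p powr (real 1 * \<theta>)" by (rule C) simp
  finally have Cge: "C \<ge> 0" using p2 by (simp add: zero_le_mult_iff)
  have Rl: "C * l * geom_const * real p powr (- 2 * (Re s - \<theta>)) \<le> R * norm u"
  proof -
    have "C * l * geom_const * real p powr (- 2 * (Re s - \<theta>))
        = R * (real p powr (- \<epsilon>) * real p powr (- Re s) * l)"
      by (simp add: R_def mult_ac algebra_simps flip: powr_add)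
    also have "\<dots> \<le> R * norm u" using Cge geom_const_nonneg by (intro mult_left_mono up) (simp add: R_def)
    finally show ?thesis .
  qed
  have k2: "real k \<le> (real k)\<^sup>2" for k :: nat by (cases "k = 0") (auto simp: self_le_power)
  have "norm (log_factor' b p s - u) \<le> C * l * geom_const * real p powr (- 2 * (Re s - \<theta>))"
  proof -
    have "norm (- of_real (real k * ln (real p)) * b (p ^ k)) \<le> C * l * (real k)\<^sup>2 * real p powr (real k * \<theta>)"
      if "k \<ge> 2" for k
    proof -
      have "norm (- of_real (real k * ln (real p)) * b (p ^ k)) = real k * l * norm (b (p ^ k))"
        using l by (simp add: norm_mult l_def)
      also have "\<dots> \<le> (real k)\<^sup>2 * l * (C * real p powr (real k * \<theta>))"
        using l k2 that by (intro mult_mono mult_right_mono C) auto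
      finally show ?thesis by (simp add: mult_ac)
    qed
    from gds_powers_first_term[OF conv1 p this s \<theta>] show ?thesis
      unfolding log_factor'_def u_def l_def by simp
  qed
  then have d1: "norm (log_factor' b p s - u) \<le> R * norm u" using Rl by simp
  \<comment> \<open>Adding \<open>ln p\<close> times the first derivative to the second replaces the
    weight \<open>k^2\<close> by \<open>k * (k - 1)\<close>, so the leading term cancels.\<close>
  let ?d = "\<lambda>k. of_real l * (- of_real (real k * ln (real p)) * b (p ^ k)) +
    - of_real (real k * ln (real p)) * (- of_real (real k * ln (real p)) * b (p ^ k))"
  have sum_eq: "of_real l * log_factor' b p s + log_factor'' b p s = gds {1..} ?d (\<lambda>k. real k * ln (real p)) s"
  proof -
    have "gds {1..} ?d (\<lambda>k. real k * ln (real p)) s =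
      (\<Sum>\<^sub>\<infinity>k\<in>{1..}. of_real l * (- of_real (real k * ln (real p)) * b (p ^ k) * exp (- (of_real (real k * ln (real p)) * s)))
       + - of_real (real k * ln (real p)) * (- of_real (real k * ln (real p)) * b (p ^ k)) * exp (- (of_real (real k * ln (real p)) * s)))"
      unfolding gds_def by (intro infsum_cong) (simp only: distrib_right mult.assoc)
    also have "\<dots> = of_real l * log_factor' b p s + log_factor'' b p s"
      unfolding log_factor'_def log_factor''_def gds_def
      by (subst infsum_add) (intro summable_on_cmult_right gds_conv_summable[OF conv1 s] gds_conv_summable[OF conv2 s],
          intro gds_conv_summable[OF conv2 s], simp only: infsum_cmult_right')
    finally show ?thesis by simp
  qed
  have dk: "?d k = of_real ((real k - 1) * real k * l\<^sup>2) * b (p ^ k)" for k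
    by (simp add: l_def power2_eq_square algebra_simps)
  have norm_d: "norm (?d k) = (real k - 1) * real k * l\<^sup>2 * norm (b (p ^ k))" if "k \<ge> 1" for k
  proof -
    have "(real k - 1) * real k * l\<^sup>2 \<ge> 0" using that by (intro mult_nonneg_nonneg) auto
    then show ?thesis unfolding dk norm_mult norm_of_real by (simp only: abs_of_nonneg)
  qed
  have convd: "gds_conv {1..} ?d (\<lambda>k. real k * ln (real p))"
  proof -
      have *: "(\<lambda>k. norm (?d k) * exp (- (real k * ln (real p) * \<sigma>))) summable_on {1..}" if "\<sigma> > 1" for \<sigma>
      proof (rule summable_on_comparison_test)
        show "(\<lambda>k. norm (- of_real (real k * ln (real p)) * (- of_real (real k * ln (real p)) * b (p ^ k))) *
            exp (- (real k * ln (real p) * \<sigma>))) summable_on {1..}"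
          using conv2 that by (simp only: gds_conv_def)
        fix k :: nat assume k: "k \<in> {1..}"
        have "(real k - 1) * real k \<le> real k * real k" by (intro mult_right_mono) auto
        then have "(real k - 1) * real k * l\<^sup>2 * norm (b (p ^ k)) \<le> real k * real k * l\<^sup>2 * norm (b (p ^ k))"
          by (intro mult_right_mono) auto
        then show "norm (?d k) * exp (- (real k * ln (real p) * \<sigma>)) \<le>
           norm (- of_real (real k * ln (real p)) * (- of_real (real k * ln (real p)) * b (p ^ k))) *
            exp (- (real k * ln (real p) * \<sigma>))"
          using norm_d[of k] k l
          by (intro mult_right_mono) (auto simp: norm_mult l_def power2_eq_square mult_ac simp del: of_real_mult)
      qed auto
      show ?thesis unfolding gds_conv_def using * conv0[unfolded gds_conv_def] by blast
  qed
  have "norm (?d k) \<le> C * l\<^sup>2 * (real k)\<^sup>2 * real p powr (real k * \<theta>)" if "k \<ge> 2" for k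
  proof -
    have "norm (?d k) = (real k - 1) * real k * l\<^sup>2 * norm (b (p ^ k))"
      by (rule norm_d) (use that in simp)
    also have "\<dots> \<le> (real k)\<^sup>2 * l\<^sup>2 * (C * real p powr (real k * \<theta>))"
      using that by (intro mult_mono C) (auto simp: power2_eq_square)
    finally show ?thesis by (simp add: mult_ac)
  qed
  \<comment> \<open>As \<open>?d 1 = 0\<close>, the tail bound applies to the whole series.\<close>
  from gds_powers_first_term[OF convd p this s \<theta>]
  have "norm (of_real l * log_factor' b p s + log_factor'' b p s) \<le> l * (C * l * geom_const * real p powr (- 2 * (Re s - \<theta>)))"
    unfolding sum_eq by (simp add: l_def power2_eq_square mult_ac)
  also have "\<dots> \<le> l * (R * norm u)" using Rl l by (intro mult_left_mono) auto
  also have "\<dots> = (l * R) * norm u" by simp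
  also have "\<dots> \<le> 1 / 8 * norm u" using lr by (intro mult_right_mono) (auto simp: l_def R_def)
  finally have d2: "norm (of_real l * log_factor' b p s + log_factor'' b p s) \<le> 1 / 8 * norm u" .
  \<comment> \<open>A relative error of \<open>1/2\<close> keeps the denominator at least
    \<open>norm u / 2\<close>; with the numerator at most \<open>norm u / 8\<close> the quotient is
    at most \<open>1/4\<close>.\<close>
  have "norm (log_factor' b p s - u) \<le> 1 / 2 * norm u"
    using d1 mult_right_mono[OF r, of "norm u"] unfolding R_def by simp
  then have low: "norm (log_factor' b p s) \<ge> norm u / 2"
    using norm_triangle_ineq2[of u "log_factor' b p s"] by (simp add: norm_minus_commute)
  then show ne: "log_factor' b p s \<noteq> 0" using u by auto
  have "norm (log_factor'' b p s / log_factor' b p s + of_real (ln (real p)))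
      = norm (of_real l * log_factor' b p s + log_factor'' b p s) / norm (log_factor' b p s)"
    using ne by (simp add: l_def field_simps flip: norm_divide)
  also have "\<dots> \<le> (1 / 8 * norm u) / (norm u / 2)"
    using d2 low u by (intro frac_le) auto
  also have "\<dots> = 1 / 4" using u by simp
  finally show "norm (log_factor'' b p s / log_factor' b p s + of_real (ln (real p))) \<le> 1 / 4" .
qed

section \<open>Conclusion\<close>

text \<open>The Euler factor at \<open>p\<close> plays the role of \<open>f\<close>, and the rest of
  the twisted logarithm, less \<open>c\<close>, that of \<open>Q\<close>. Shifting \<open>f\<close>
  by \<open>x\<close> replaces \<open>w p\<close> by \<open>w p + x\<close>, so \<open>line\<close>
  confines the zeros for all real \<open>x\<close>.\<close>

lemma twisted_log_zero_shift:
  assumes conv: "log_conv b" and p: "prime p" and \<delta>: "\<delta> > 0" "\<beta> - \<delta> > 1"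
    and line: "\<forall>w s. \<bar>Re s - \<beta>\<bar> < \<delta> \<longrightarrow> twisted_log b w s = c \<longrightarrow> Re s = \<beta>"
    and s0: "Re s\<^sub>0 = \<beta>" "twisted_log b w s\<^sub>0 = c"
    and ne: "log_factor' b p (s\<^sub>0 + \<i> * of_real (w p)) \<noteq> 0"
  shows "deriv (twisted_log b w) s\<^sub>0 \<noteq> 0"
    "log_factor' b p (s\<^sub>0 + \<i> * of_real (w p)) / deriv (twisted_log b w) s\<^sub>0 \<in> \<real>"
    "\<exists>e>0. \<forall>y. \<bar>y - Im s\<^sub>0\<bar> < e \<longrightarrow> (\<exists>x. twisted_log b (w(p := x)) (Complex \<beta> y) = c)"
proof -
  define f where "f z = log_factor b p (z + \<i> * of_real (w p))" for z
  define Q where "Q z = twisted_log b w z - c - f z" for z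
  have near: "\<bar>Re z - \<beta>\<bar> < \<delta>" "Re z > 1" if "z \<in> ball s\<^sub>0 \<delta>" for z
  proof -
    have "norm (z - s\<^sub>0) < \<delta>" using that by (simp add: dist_norm norm_minus_commute)
    then show "\<bar>Re z - \<beta>\<bar> < \<delta>" using abs_Re_le_cmod[of "z - s\<^sub>0"] s0(1) by simp
    then show "Re z > 1" using \<delta> by linarith
  qed
  have df: "(f has_field_derivative log_factor' b p (z + \<i> * of_real (w p))) (at z)" if "Re z > 1" for z
  proof -
    have "((\<lambda>z. z + \<i> * of_real (w p)) has_field_derivative 1) (at z)"
      by (auto intro!: derivative_eq_intros)
    from DERIV_chain2[OF log_factor_has_derivative(1)[OF conv p, of "z + \<i> * of_real (w p)"] this]
    show ?thesis using that unfolding f_def by simp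
  qed
  have dT: "twisted_log b w field_differentiable at z" if "Re z > 1" for z
    using twisted_log_holomorphic[OF conv, of w] that open_halfspace_Re_gt
    by (auto simp: holomorphic_on_open field_differentiable_def)
  have s01: "Re s\<^sub>0 > 1" using near[of s\<^sub>0] \<delta> by simp
  have df0: "deriv f s\<^sub>0 = log_factor' b p (s\<^sub>0 + \<i> * of_real (w p))"
    by (rule DERIV_imp_deriv[OF df[OF s01]])
  have dfield: "f field_differentiable at z" if "Re z > 1" for z
    using df[OF that] by (auto simp: field_differentiable_def)
  have holf: "f holomorphic_on ball s\<^sub>0 \<delta>"
    by (rule holomorphic_onI, rule field_differentiable_at_within, rule dfield, rule near(2))
  have holT: "twisted_log b w holomorphic_on ball s\<^sub>0 \<delta>"
    by (rule holomorphic_onI, rule field_differentiable_at_within, rule dT, rule near(2))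
  have holQ: "Q holomorphic_on ball s\<^sub>0 \<delta>"
    unfolding Q_def by (intro holomorphic_intros holT holf)
  have "((\<lambda>z. twisted_log b w z - c - f z) has_field_derivative (deriv (twisted_log b w) s\<^sub>0 - 0 - deriv f s\<^sub>0)) (at s\<^sub>0)"
    by (intro derivative_intros field_differentiable_derivI dT dfield s01)
  then have dQ: "deriv Q s\<^sub>0 + deriv f s\<^sub>0 = deriv (twisted_log b w) s\<^sub>0"
    unfolding Q_def[abs_def] by (simp add: DERIV_imp_deriv)
  have shift: "Q s + f (s + \<i> * of_real x) = twisted_log b (w(p := w p + x)) s - c" if "Re s > 1" for s x
    unfolding Q_def f_def twisted_log_upd[OF conv p that] by (simp add: algebra_simps)
  have zero: "Q s\<^sub>0 + f s\<^sub>0 = 0" using s0(2) by (simp add: Q_def)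
  have only: "Re s = Re s\<^sub>0" if "s \<in> ball s\<^sub>0 \<delta>" "Q s + f (s + \<i> * of_real x) = 0" for s x
  proof -
    have "twisted_log b (w(p := w p + x)) s = c" using that(2) shift[OF near(2)[OF that(1)]] by simp
    then show ?thesis using line near(1)[OF that(1)] s0(1) by blast
  qed
  have dfne: "deriv f s\<^sub>0 \<noteq> 0" using ne df0 by simp
  have Z: "deriv Q s\<^sub>0 + deriv f s\<^sub>0 \<noteq> 0" "deriv f s\<^sub>0 / (deriv Q s\<^sub>0 + deriv f s\<^sub>0) \<in> \<real>"
    "\<exists>e>0. \<forall>y. \<bar>y - Im s\<^sub>0\<bar> < e \<longrightarrow>
       (\<exists>x. Q (Complex (Re s\<^sub>0) y) + f (Complex (Re s\<^sub>0) y + \<i> * of_real x) = 0)"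
    by (rule zeros_of_vertical_shifts_on_line[OF \<delta>(1) holQ holf zero dfne]; rule only; assumption)+
  show "deriv (twisted_log b w) s\<^sub>0 \<noteq> 0" using Z(1) dQ by simp
  show "log_factor' b p (s\<^sub>0 + \<i> * of_real (w p)) / deriv (twisted_log b w) s\<^sub>0 \<in> \<real>"
    using Z(2) dQ df0 by simp
  obtain e where e: "e > 0" "\<And>y. \<bar>y - Im s\<^sub>0\<bar> < e \<Longrightarrow>
      \<exists>x. Q (Complex (Re s\<^sub>0) y) + f (Complex (Re s\<^sub>0) y + \<i> * of_real x) = 0"
    using Z(3) by blast
  have "\<exists>x. twisted_log b (w(p := x)) (Complex \<beta> y) = c" if y: "\<bar>y - Im s\<^sub>0\<bar> < e" for y
  proof -
    obtain x where "Q (Complex \<beta> y) + f (Complex \<beta> y + \<i> * of_real x) = 0" using e(2)[OF y] s0(1) by auto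
    then have "twisted_log b (w(p := w p + x)) (Complex \<beta> y) = c"
      using shift[of "Complex \<beta> y" x] s01 s0(1) by simp
    then show ?thesis by blast
  qed
  then show "\<exists>e>0. \<forall>y. \<bar>y - Im s\<^sub>0\<bar> < e \<longrightarrow> (\<exists>x. twisted_log b (w(p := x)) (Complex \<beta> y) = c)"
    using e(1) by blast
qed

text \<open>The quotient \<open>q = f / g\<close> is real along the line, so its vertical derivative
  \<open>\<i> * q'\<close> is real and \<open>Re q' = 0\<close>. Now
  \<open>q' = q * (f' / f - g' / g)\<close>, with \<open>q\<close> real and nonzero at
  \<open>s\<close>.\<close>

lemma real_quotient_on_vertical_line:
  assumes f: "(f has_field_derivative f') (at s)" and g: "(g has_field_derivative g') (at s)"
    and ne: "f s \<noteq> 0" "g s \<noteq> 0" and e: "e > 0"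
    and real: "\<And>y. \<bar>y - Im s\<bar> < e \<Longrightarrow> f (Complex (Re s) y) / g (Complex (Re s) y) \<in> \<real>"
  shows "Re (f' / f s) = Re (g' / g s)"
proof -
  define q where "q z = f z / g z" for z
  define X where "X = (f' * g s - f s * g') / (g s * g s)"
  have q: "(q has_field_derivative X) (at s)"
    unfolding q_def X_def by (rule DERIV_divide[OF f g ne(2)])
  have "((\<lambda>y. Complex (Re s) y) has_vector_derivative \<i>) (at (Im s))"
    unfolding Complex_eq by (auto intro!: derivative_eq_intros)
  from field_vector_diff_chain_at[OF this, of q X] q
  have "((\<lambda>y. q (Complex (Re s) y)) has_vector_derivative (\<i> * X)) (at (Im s))"
    by (simp add: o_def)
  from bounded_linear.has_vector_derivative[OF bounded_linear_Im this]
  have "((\<lambda>y. Im (q (Complex (Re s) y))) has_real_derivative Re X) (at (Im s))"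
    by (simp add: has_real_derivative_iff_has_vector_derivative)
  moreover have im0: "Im (q (Complex (Re s) y)) = 0" if "\<bar>y - Im s\<bar> < e" for y
    using real[OF that] by (simp only: q_def complex_is_Real_iff)
  ultimately have X0: "Re X = 0"
  proof (elim DERIV_local_const[OF _ e])
    show "\<forall>y. \<bar>Im s - y\<bar> < e \<longrightarrow> Im (q (Complex (Re s) (Im s))) = Im (q (Complex (Re s) y))"
      using im0[of "Im s"] im0 e by (auto simp: abs_minus_commute)
  qed
  have "q s \<in> \<real>" using real[of "Im s"] e by (simp add: q_def)
  then obtain r where r: "q s = of_real r" by (auto elim: Reals_cases)
  have "r \<noteq> 0" using r ne by (auto simp: q_def)
  have "X = q s * (f' / f s - g' / g s)" using ne by (simp add: X_def q_def field_simps)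
  then have "Re X = r * (Re (f' / f s) - Re (g' / g s))" unfolding r by simp
  then show ?thesis using X0 \<open>r \<noteq> 0\<close> by simp
qed

theorem theorem13:
  fixes a b :: "nat \<Rightarrow> complex" and \<kappa> :: real and c :: complex
  assumes "cond_I a"
    and "cond_II a b"
    and "\<kappa> > 0"
    and "(\<lambda>x::real. (\<Sum>p | prime p \<and> real p \<le> x. (norm (a p))\<^sup>2 / real p) - \<kappa> * ln (ln x))
           \<in> o[at_top](\<lambda>x. ln (ln x))"
  shows "\<forall>\<beta>\<^sub>0>1. \<not> isolated_zero_line (\<lambda>s. log_dirichlet_series b s - c) \<beta>\<^sub>0"
proof (intro allI impI notI)
  fix \<beta> :: real assume \<beta>: "\<beta> > 1"
  assume iso: "isolated_zero_line (\<lambda>s. log_dirichlet_series b s - c) \<beta>"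
  note conv = cond_II_imp_log_conv[OF assms(2)]
  obtain \<theta> C where \<theta>: "\<theta> < 1 / 2"
    and C: "\<And>p k. prime p \<Longrightarrow> k \<ge> 1 \<Longrightarrow> norm (b (p ^ k)) \<le> C * real p powr (real k * \<theta>)"
    using assms(2) unfolding cond_II_def by blast
  \<comment> \<open>Positive since \<open>2 * \<theta> < 1 < \<beta>\<close>. With this choice the
    relative errors of the Euler factors on the line decay like
    \<open>p powr (- \<epsilon>)\<close>, up to a factor \<open>ln p\<close>.\<close>
  define \<epsilon> where "\<epsilon> = (\<beta> - 2 * \<theta>) / 2"
  have \<epsilon>: "\<epsilon> > 0" "\<epsilon> - (\<beta> - 2 * \<theta>) = - \<epsilon>" using \<beta> \<theta> by (auto simp: \<epsilon>_def field_simps)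
  have "((\<lambda>n. C * geom_const * real n powr (- \<epsilon>)) \<longlongrightarrow> C * geom_const * 0) sequentially"
    using \<epsilon>(1) by (intro tendsto_mult_left tendsto_neg_powr filterlim_real_sequentially) auto
  then have ev1: "\<forall>\<^sub>F n in sequentially. C * geom_const * real n powr (- \<epsilon>) < 1 / 2"
    by (rule order_tendstoD) simp
  have "((\<lambda>n. C * geom_const * (ln (real n) * real n powr (- \<epsilon>))) \<longlongrightarrow> C * geom_const * 0) sequentially"
    using lim_ln_over_power[OF \<epsilon>(1)] by (intro tendsto_mult_left) (simp add: powr_minus_divide)
  then have ev2: "\<forall>\<^sub>F n in sequentially. C * geom_const * (ln (real n) * real n powr (- \<epsilon>)) < 1 / 8"
    by (rule order_tendstoD) simp
  obtain N where N: "\<And>n. n \<ge> N \<Longrightarrow> C * geom_const * real n powr (- \<epsilon>) < 1 / 2"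
    "\<And>n. n \<ge> N \<Longrightarrow> C * geom_const * (ln (real n) * real n powr (- \<epsilon>)) < 1 / 8"
    using eventually_conj[OF ev1 ev2] unfolding eventually_sequentially by blast
  define good where "good p \<longleftrightarrow> prime p \<and> p \<ge> N \<and> norm (b p) \<ge> real p powr (- \<epsilon>)" for p
  have ex_good: "\<exists>p>M. good p" for M
    using exists_large_prime_coeff[OF assms(3,4,1,2) \<epsilon>(1), of "max M N"]
    unfolding good_def by (metis max_less_iff_conj less_imp_le)
  have good: "log_factor' b p s \<noteq> 0"
    "norm (log_factor'' b p s / log_factor' b p s + of_real (ln (real p))) \<le> 1 / 4"
    if "good p" "Re s = \<beta>" for p s
  proof -
    have p: "prime p" "p \<ge> N" "norm (b p) \<ge> real p powr (- \<epsilon>)" using that(1) by (auto simp: good_def)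
    have s: "Re s > 1" "\<epsilon> - (Re s - 2 * \<theta>) = - \<epsilon>" using that(2) \<beta> \<epsilon>(2) by auto
    have r: "C * geom_const * real p powr (\<epsilon> - (Re s - 2 * \<theta>)) \<le> 1 / 2"
      "ln (real p) * (C * geom_const * real p powr (\<epsilon> - (Re s - 2 * \<theta>))) \<le> 1 / 8"
      using N[OF p(2)] unfolding s(2) by (simp_all add: mult_ac)
    note log_factor_logarithmic_derivative[OF conv p(1) s(1) \<theta> C[OF p(1)] p(3) r]
    then show "log_factor' b p s \<noteq> 0"
      "norm (log_factor'' b p s / log_factor' b p s + of_real (ln (real p))) \<le> 1 / 4" by blast+
  qed
  \<comment> \<open>\<open>p1\<close> and \<open>p2\<close> are compared, while \<open>p3\<close>
    moves the zero. The factor \<open>2\<close> gives \<open>ln p2 - ln p1 > ln 2 > 1/2\<close>,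
    more than the two errors of \<open>1/4\<close> allow.\<close>
  obtain p1 where p1: "good p1" using ex_good by blast
  obtain p2 where p2: "good p2" "p2 > 2 * p1" using ex_good by blast
  obtain p3 where p3: "good p3" "p3 > p2" using ex_good by blast
  have pr: "prime p1" "prime p2" "prime p3" using p1 p2 p3 by (auto simp: good_def)
  have "b p1 \<noteq> 0" using p1 prime_gt_0_nat[OF pr(1)] by (auto simp: good_def)
  from isolated_zero_line_twisted[OF conv pr(1) this \<beta> iso]
  obtain \<delta> where \<delta>: "\<delta> > 0" "\<beta> - \<delta> > 1"
    and line: "\<forall>w s. \<bar>Re s - \<beta>\<bar> < \<delta> \<longrightarrow> twisted_log b w s = c \<longrightarrow> Re s = \<beta>" by blast
  obtain s where s: "Re s = \<beta>" "twisted_log b (\<lambda>_. 0) s = c"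
    using iso unfolding isolated_zero_line_def log_dirichlet_series_eq by auto
  have "log_factor' b p3 (s + \<i> * of_real ((\<lambda>_. 0) p3)) \<noteq> 0" using good(1)[OF p3(1) s(1)] by simp
  \<comment> \<open>Varying the shift at \<open>p3\<close> alone carries the zero to every nearby
    point of the line. The shifts at \<open>p1\<close> and \<open>p2\<close> stay \<open>0\<close>,
    so their factors are evaluated at the zero itself.\<close>
  from twisted_log_zero_shift(3)[OF conv pr(3) \<delta> line s this]
  obtain e where e: "e > 0" "\<And>y. \<bar>y - Im s\<bar> < e \<Longrightarrow>
      \<exists>x. twisted_log b ((\<lambda>_. 0)(p3 := x)) (Complex \<beta> y) = c"
    by blast
  have real: "log_factor' b p1 (Complex (Re s) y) / log_factor' b p2 (Complex (Re s) y) \<in> \<real>"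
    if y: "\<bar>y - Im s\<bar> < e" for y
  proof -
    obtain x where x: "twisted_log b ((\<lambda>_. 0)(p3 := x)) (Complex \<beta> y) = c" using e(2)[OF y] by blast
    let ?w = "(\<lambda>_. 0)(p3 := x)" and ?z = "Complex \<beta> y"
    have w: "?w p1 = 0" "?w p2 = 0" using p2 p3 by auto
    have quot: "deriv (twisted_log b ?w) ?z \<noteq> 0 \<and> log_factor' b p ?z / deriv (twisted_log b ?w) ?z \<in> \<real>"
      if "good p" "?w p = 0" for p
    proof -
      have z: "Re ?z = \<beta>" by simp
      have p: "prime p" using that(1) by (simp add: good_def)
      have eq: "?z + \<i> * of_real (?w p) = ?z" unfolding that(2) by simp
      have "log_factor' b p (?z + \<i> * of_real (?w p)) \<noteq> 0" unfolding eq by (rule good(1)[OF that(1) z])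
      from twisted_log_zero_shift(1,2)[OF conv p \<delta> line z x this] show ?thesis unfolding eq by blast
    qed
    \<comment> \<open>Both derivatives are real multiples of the derivative of one and the same
      twist, which cancels in the quotient although the twist changes with \<open>y\<close>.\<close>
    have "(log_factor' b p1 ?z / deriv (twisted_log b ?w) ?z) / (log_factor' b p2 ?z / deriv (twisted_log b ?w) ?z) \<in> \<real>"
      by (rule Reals_divide[OF conjunct2[OF quot[OF p1 w(1)]] conjunct2[OF quot[OF p2(1) w(2)]]])
    then show ?thesis using quot[OF p1 w(1)] s(1) by simp
  qed
  have s1: "Re s > 1" using s \<beta> by simp
  have "Re (log_factor'' b p1 s / log_factor' b p1 s) = Re (log_factor'' b p2 s / log_factor' b p2 s)"
    by (rule real_quotient_on_vertical_line[OF log_factor_has_derivative(2)[OF conv pr(1) s1]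
          log_factor_has_derivative(2)[OF conv pr(2) s1] good(1)[OF p1 s(1)] good(1)[OF p2(1) s(1)] e(1) real])
  moreover have re: "\<bar>Re (log_factor'' b p s / log_factor' b p s) + ln (real p)\<bar> \<le> 1 / 4" if "good p" for p
    using abs_Re_le_cmod[of "log_factor'' b p s / log_factor' b p s + of_real (ln (real p))"] good(2)[OF that s(1)]
    by (simp del: Re_divide_of_real)
  ultimately have "ln (real p2) - ln (real p1) \<le> 1 / 2"
    using re[OF p1] re[OF p2(1)] by linarith
  moreover have "ln (real p2) > ln (2 * real p1)"
    using p2(2) prime_gt_0_nat[OF pr(1)] by (subst ln_less_cancel_iff) auto
  then have "ln (real p2) > ln 2 + ln (real p1)" using prime_gt_0_nat[OF pr(1)] by (simp add: ln_mult)
  ultimately show False using ln2_ge_two_thirds by linarith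
qed

end
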